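(* Let $1\le q<p<+\infty$ and set $r=pq/(p-q)$. Let $(\Omega,\mathcal A,\mu)$ be a $\sigma$-finite separable measure space, with diffuse part $\Omega_d$, and let $u\in L^r(\mu)$. Let $M_u:L^p(\mu)\to L^q(\mu)$, $f\mapsto uf$. Then $\|M_u\|_{e,p\to q}=\|u_{|\Omega_d}\|_r$.
   Context: A $\sigma$-finite measure space $(\Omega,\mathcal A,\mu)$ can be decomposed as a disjoint union $\Omega=\Omega_d\cup\Omega_a$ with $\Omega_d,\Omega_a\in\mathcal A$, where the restriction $\mu_d$ of $\mu$ to $\Omega_d$ is diffuse (for any measurable $A\subset\Omega_d$ with $\mu_d(A)>0$ and any $\alpha\in(0,\mu_d(A))$ there is $A'\in\mathcal A$, $A'\subset A$, with $\mu_d(A')=\alpha$) and the restriction $\mu_a$ of $\mu$ to $\Omega_a$ is purely atomic ($\Omega_a$ is the disjoint union of a finite or infinite, possibly empty, sequence $(A_n)$ of atoms, i.e. every measurable subset of $A_n$ has measure $0$ or $\mu_a(A_n)$). The measure space is called separable if there exists a sequence $(B_n)\subset\mathcal A$ such that for any $B\in\mathcal A$ and any $\varepsilon>0$ there is $n\ge1$ with $\mu(B\Delta B_n)<\varepsilon$. $L^p(\mu)$ denotes complex-valued functions. $\|u_{|\Omega_d}\|_r=\left(\int_{\Omega_d}|u|^r\,d\mu\right)^{1/r}$. The essential norm $\|T\|_{e,p\to q}$ of a bounded operator $T:L^p(\mu)\to L^q(\mu)$ is $\inf\{\|T-K\|:\ K:L^p(\mu)\to L^q(\mu)\text{ compact}\}$.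 *)

theory Defs
  imports "HOL-Analysis.Analysis"
begin

section \<open>Measure spaces\<close>

definition diffuse_measure :: "'a measure \<Rightarrow> bool" where
  "diffuse_measure N \<longleftrightarrow>
     (\<forall>A\<in>sets N. \<forall>\<alpha>. 0 < \<alpha> \<and> \<alpha> < emeasure N A \<longrightarrow>
        (\<exists>A'\<in>sets N. A' \<subseteq> A \<and> emeasure N A' = \<alpha>))"

definition measure_atom :: "'a measure \<Rightarrow> 'a set \<Rightarrow> bool" where
  "measure_atom N A \<longleftrightarrow>
     A \<in> sets N \<and> (\<forall>B\<in>sets N. B \<subseteq> A \<longrightarrow> emeasure N B = 0 \<or> emeasure N B = emeasure N A)"

text \<open>The index set \<open>I\<close> makes the sequence of atoms finite, infinite or empty.\<close>

definition purely_atomic_measure :: "'a measure \<Rightarrow> bool" where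
  "purely_atomic_measure N \<longleftrightarrow>
     (\<exists>(I :: nat set) A. disjoint_family_on A I \<and> (\<forall>n\<in>I. measure_atom N (A n)) \<and>
        space N = (\<Union>n\<in>I. A n))"

definition diffuse_atomic_decomposition :: "'a measure \<Rightarrow> 'a set \<Rightarrow> 'a set \<Rightarrow> bool" where
  "diffuse_atomic_decomposition M \<Omega>d \<Omega>a \<longleftrightarrow>
     \<Omega>d \<in> sets M \<and> \<Omega>a \<in> sets M \<and> \<Omega>d \<inter> \<Omega>a = {} \<and> \<Omega>d \<union> \<Omega>a = space M \<and>
     diffuse_measure (restrict_space M \<Omega>d) \<and> purely_atomic_measure (restrict_space M \<Omega>a)"

text \<open>The approximated set \<open>B\<close> ranges over all measurable sets, including those of infinite
  measure.\<close>

definition separable_measure :: "'a measure \<Rightarrow> bool" where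
  "separable_measure M \<longleftrightarrow>
     (\<exists>Bs :: nat \<Rightarrow> 'a set. range Bs \<subseteq> sets M \<and>
        (\<forall>B\<in>sets M. \<forall>\<epsilon>::real. \<epsilon> > 0 \<longrightarrow>
           (\<exists>n. emeasure M ((B - Bs n) \<union> (Bs n - B)) < ennreal \<epsilon>)))"

section \<open>\<open>L\<^sup>p\<close> spaces and operators between them\<close>

text \<open>
  The space \<open>L\<^sup>p(M)\<close> is handled through representatives: \<open>Lp M p\<close> is the set of complex
  measurable functions with integrable \<open>p\<close>-th power, and elements that agree almost everywhere
  are identified by hand.  Accordingly an operator \<open>L\<^sup>p(M) \<rightarrow> L\<^sup>q(M)\<close> is a map on functions that
  respects almost everywhere equality and is linear up to almost everywhere equality; its values
  outside \<open>Lp M p\<close> are irrelevant.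
\<close>

definition Lp :: "'a measure \<Rightarrow> real \<Rightarrow> ('a \<Rightarrow> complex) set" where
  "Lp M p = {f \<in> borel_measurable M. integrable M (\<lambda>x. norm (f x) powr p)}"

definition Lp_norm :: "'a measure \<Rightarrow> real \<Rightarrow> ('a \<Rightarrow> complex) \<Rightarrow> real" where
  "Lp_norm M p f = (\<integral>x. norm (f x) powr p \<partial>M) powr (1 / p)"

definition Lp_bounded_operator ::
    "'a measure \<Rightarrow> real \<Rightarrow> real \<Rightarrow> (('a \<Rightarrow> complex) \<Rightarrow> ('a \<Rightarrow> complex)) \<Rightarrow> bool" where
  "Lp_bounded_operator M p q T \<longleftrightarrow>
     (\<forall>f\<in>Lp M p. T f \<in> Lp M q) \<and>
     (\<forall>f\<in>Lp M p. \<forall>g\<in>Lp M p. (AE x in M. f x = g x) \<longrightarrow> (AE x in M. T f x = T g x)) \<and>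
     (\<forall>f\<in>Lp M p. \<forall>g\<in>Lp M p. AE x in M. T (\<lambda>y. f y + g y) x = T f x + T g x) \<and>
     (\<forall>f\<in>Lp M p. \<forall>c. AE x in M. T (\<lambda>y. c * f y) x = c * T f x) \<and>
     (\<exists>C. \<forall>f\<in>Lp M p. Lp_norm M q (T f) \<le> C * Lp_norm M p f)"

text \<open>Compactness: the image of every bounded sequence has a subsequence converging in
  \<open>L\<^sup>q(M)\<close>.\<close>

definition Lp_compact_operator ::
    "'a measure \<Rightarrow> real \<Rightarrow> real \<Rightarrow> (('a \<Rightarrow> complex) \<Rightarrow> ('a \<Rightarrow> complex)) \<Rightarrow> bool" where
  "Lp_compact_operator M p q K \<longleftrightarrow>
     Lp_bounded_operator M p q K \<and>
     (\<forall>f :: nat \<Rightarrow> 'a \<Rightarrow> complex. (\<forall>n. f n \<in> Lp M p) \<and> (\<exists>C. \<forall>n. Lp_norm M p (f n) \<le> C) \<longrightarrow>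
        (\<exists>s g. strict_mono s \<and> g \<in> Lp M q \<and>
           (\<lambda>n. Lp_norm M q (\<lambda>x. K (f (s n)) x - g x)) \<longlonglongrightarrow> 0))"

definition Lp_operator_norm ::
    "'a measure \<Rightarrow> real \<Rightarrow> real \<Rightarrow> (('a \<Rightarrow> complex) \<Rightarrow> ('a \<Rightarrow> complex)) \<Rightarrow> real" where
  "Lp_operator_norm M p q T = (SUP f\<in>{f \<in> Lp M p. Lp_norm M p f \<le> 1}. Lp_norm M q (T f))"

definition Lp_essential_norm ::
    "'a measure \<Rightarrow> real \<Rightarrow> real \<Rightarrow> (('a \<Rightarrow> complex) \<Rightarrow> ('a \<Rightarrow> complex)) \<Rightarrow> real" where
  "Lp_essential_norm M p q T =
     (INF K\<in>{K. Lp_compact_operator M p q K}. Lp_operator_norm M p q (\<lambda>f x. T f x - K f x))"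

definition multiplication_operator ::
    "('a \<Rightarrow> complex) \<Rightarrow> ('a \<Rightarrow> complex) \<Rightarrow> ('a \<Rightarrow> complex)" where
  "multiplication_operator u f = (\<lambda>x. u x * f x)"

text \<open>The real-valued supremum and infimum above carry their usual meaning for bounded
  operators only.  The facts below cover this: \<open>multiplication_operator u\<close> is bounded under the
  assumptions \<open>1 \<le> q < p\<close>, \<open>u \<in> L\<^sup>r\<close>, the supremum of a bounded operator is over a set that is
  bounded above, and the zero operator is compact.\<close>

lemma Lp_operator_norm_bdd_above:
  assumes "Lp_bounded_operator M p q T"
  shows "bdd_above ((\<lambda>f. Lp_norm M q (T f)) ` {f \<in> Lp M p. Lp_norm M p f \<le> 1})"
proof -
  obtain C where C: "\<And>f. f \<in> Lp M p \<Longrightarrow> Lp_norm M q (T f) \<le> C * Lp_norm M p f"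
    using assms unfolding Lp_bounded_operator_def by blast
  have "Lp_norm M q (T f) \<le> \<bar>C\<bar>" if "f \<in> Lp M p" "Lp_norm M p f \<le> 1" for f
  proof -
    have "0 \<le> Lp_norm M p f" by (simp add: Lp_norm_def)
    have "C * Lp_norm M p f \<le> \<bar>C\<bar> * Lp_norm M p f"
      using \<open>0 \<le> Lp_norm M p f\<close> by (intro mult_right_mono) auto
    also have "\<dots> \<le> \<bar>C\<bar> * 1"
      using that by (intro mult_left_mono) auto
    finally show ?thesis using C[OF that(1)] by simp
  qed
  then show ?thesis by (intro bdd_aboveI[of _ "\<bar>C\<bar>"]) auto
qed

lemma zero_Lp_compact_operator: "Lp_compact_operator M p q (\<lambda>f x. 0)"
proof -
  have z: "(\<lambda>x. 0) \<in> Lp M q" "Lp_norm M q (\<lambda>x. 0) = 0"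
    by (simp_all add: Lp_def Lp_norm_def)
  have "\<exists>s g. strict_mono (s :: nat \<Rightarrow> nat) \<and> g \<in> Lp M q \<and>
      (\<lambda>n::nat. Lp_norm M q (\<lambda>x. 0 - g x)) \<longlonglongrightarrow> 0"
    using z by (intro exI[of _ id] exI[of _ "\<lambda>x. 0"]) (simp add: strict_mono_def)
  moreover have "\<exists>C. \<forall>f\<in>Lp M p. Lp_norm M q (\<lambda>x. 0) \<le> C * Lp_norm M p f"
    using z by (intro exI[of _ 0]) simp
  ultimately show ?thesis
    using z by (auto simp: Lp_compact_operator_def Lp_bounded_operator_def)
qed

lemma norm_mult_powr_le:
  fixes a b p q r :: real
  assumes "0 \<le> a" "0 \<le> b" "1 \<le> q" "q < p" "r = p * q / (p - q)"
  shows "(a * b) powr q \<le> a powr r + b powr p"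
proof -
  have pos: "p > 0" "q > 0" "r > 0" using assms by auto
  have e1: "q * (1 + r / p) = r" and e2: "q * (1 + p / r) = p"
    using assms pos by (auto simp: field_simps)
  show ?thesis
  proof (cases "b powr p \<le> a powr r")
    case True
    have "b = (b powr p) powr (1 / p)" using assms pos by (simp add: powr_powr)
    also have "\<dots> \<le> (a powr r) powr (1 / p)" using True pos by (intro powr_mono2) auto
    finally have "b \<le> a powr (r / p)" by (simp add: powr_powr)
    then have "a * b \<le> a * a powr (r / p)" using assms by (intro mult_left_mono) auto
    also have "\<dots> = a powr (1 + r / p)" using assms pos by (cases "a = 0") (auto simp: powr_add)
    finally have "(a * b) powr q \<le> (a powr (1 + r / p)) powr q"
      using assms pos by (intro powr_mono2) auto
    also have "\<dots> = a powr r" by (simp add: powr_powr e1 mult.commute[of _ q])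
    finally show ?thesis by (smt (verit) powr_ge_zero)
  next
    case False
    have "a = (a powr r) powr (1 / r)" using assms pos by (simp add: powr_powr)
    also have "\<dots> \<le> (b powr p) powr (1 / r)" using False pos by (intro powr_mono2) auto
    finally have "a \<le> b powr (p / r)" by (simp add: powr_powr)
    then have "a * b \<le> b powr (p / r) * b" using assms by (intro mult_right_mono) auto
    also have "\<dots> = b powr (1 + p / r)" using assms pos by (cases "b = 0") (auto simp: powr_add)
    finally have "(a * b) powr q \<le> (b powr (1 + p / r)) powr q"
      using assms pos by (intro powr_mono2) auto
    also have "\<dots> = b powr p" by (simp add: powr_powr e2 mult.commute[of _ q])
    finally show ?thesis by (smt (verit) powr_ge_zero)
  qed
qed

lemma Lp_bounded_multiplication_operator:
  fixes p q r :: real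
  assumes pq: "1 \<le> q" "q < p" "r = p * q / (p - q)" and u: "u \<in> Lp M r"
  shows "Lp_bounded_operator M p q (multiplication_operator u)"
proof -
  let ?I = "\<lambda>s f. \<integral>x. norm (f x :: complex) powr s \<partial>M"
  have pos: "p > 0" "q > 0" using pq by auto
  have le: "norm (u x * f x) powr q \<le> norm (u x) powr r + norm (f x) powr p"
    for x and f :: "'a \<Rightarrow> complex"
    using norm_mult_powr_le[of "norm (u x)" "norm (f x)", OF _ _ pq] by (simp add: norm_mult)
  have um: "u \<in> borel_measurable M" "integrable M (\<lambda>x. norm (u x) powr r)"
    using u by (auto simp: Lp_def)
  have mem: "(\<lambda>x. u x * f x) \<in> Lp M q" and bd: "?I q (\<lambda>x. u x * f x) \<le> ?I r u + ?I p f"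
    if f: "f \<in> Lp M p" for f
  proof -
    have fm: "f \<in> borel_measurable M" "integrable M (\<lambda>x. norm (f x) powr p)"
      using f by (auto simp: Lp_def)
    note [measurable] = um(1) fm(1)
    have int: "integrable M (\<lambda>x. norm (u x * f x) powr q)"
    proof (rule Bochner_Integration.integrable_bound)
      show "integrable M (\<lambda>x. norm (u x) powr r + norm (f x) powr p)" using um fm by simp
      show "AE x in M. norm (norm (u x * f x) powr q) \<le> norm (norm (u x) powr r + norm (f x) powr p)"
        using le by (intro AE_I2) (smt (verit) powr_ge_zero real_norm_def)
    qed measurable
    then show "(\<lambda>x. u x * f x) \<in> Lp M q" by (simp add: Lp_def)
    have "?I q (\<lambda>x. u x * f x) \<le> (\<integral>x. norm (u x) powr r + norm (f x) powr p \<partial>M)"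
      using int um fm le by (intro integral_mono) auto
    then show "?I q (\<lambda>x. u x * f x) \<le> ?I r u + ?I p f" using um fm by simp
  qed
  define C where "C = (?I r u + 1) powr (1 / q)"
  have "Lp_norm M q (\<lambda>x. u x * f x) \<le> C * Lp_norm M p f" if f: "f \<in> Lp M p" for f
  proof (cases "?I p f = 0")
    case True
    have fm: "integrable M (\<lambda>x. norm (f x) powr p)" using f by (auto simp: Lp_def)
    have "AE x in M. norm (f x) powr p = 0"
      using True fm by (subst (asm) integral_nonneg_eq_0_iff_AE) auto
    then have "AE x in M. norm (u x * f x) powr q = 0" by eventually_elim auto
    then have "?I q (\<lambda>x. u x * f x) = 0" by (rule integral_eq_zero_AE)
    then show ?thesis by (simp add: Lp_norm_def True)
  next
    case False
    define N where "N = Lp_norm M p f"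
    have "?I p f \<ge> 0" by simp
    with False have I: "?I p f > 0" by linarith
    then have N: "N > 0" by (simp add: N_def Lp_norm_def)
    have NP: "N powr p = ?I p f"
      using I pos by (simp add: N_def Lp_norm_def powr_powr)
    define g where "g = (\<lambda>x. f x / of_real N)"
    have sc: "norm (h x / of_real N :: complex) powr s = norm (h x) powr s / N powr s"
      for h :: "'a \<Rightarrow> complex" and x s
      using N by (simp add: norm_divide powr_divide)
    have g: "g \<in> Lp M p"
      using f N unfolding g_def Lp_def by (auto simp: sc)
    have "?I p g = 1" unfolding g_def using NP I by (simp add: sc)
    then have "?I q (\<lambda>x. u x * g x) \<le> ?I r u + 1" using bd[OF g] by simp
    moreover have "?I q (\<lambda>x. u x * g x) = ?I q (\<lambda>x. u x * f x) / N powr q"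
      using sc[of "\<lambda>x. u x * f x"] by (simp add: g_def)
    ultimately have "?I q (\<lambda>x. u x * f x) \<le> (?I r u + 1) * N powr q"
      using N by (simp add: divide_le_eq)
    then have "?I q (\<lambda>x. u x * f x) powr (1 / q) \<le> ((?I r u + 1) * N powr q) powr (1 / q)"
      using pos by (intro powr_mono2) auto
    also have "\<dots> = C * N" using N pos by (simp add: C_def powr_mult powr_powr)
    finally show ?thesis by (simp add: Lp_norm_def N_def)
  qed
  then show ?thesis
    using mem unfolding Lp_bounded_operator_def multiplication_operator_def
    by (auto simp: algebra_simps)
qed

end

theory Submission
  imports Defs "HOL-Real_Asymp.Real_Asymp"
begin

text \<open>
  Upper bound: a measurable function is almost everywhere constant on an atom, so multiplication by
  \<open>u\<close> restricted to finitely many atoms is compact. Subtracting it leaves multiplication by \<open>u\<close>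
  restricted to the rest, whose norm is at most the \<open>L\<^sup>r\<close> norm of that restriction by Hoelder's
  inequality; let the number of atoms grow.

  Lower bound: let \<open>E \<subseteq> \<Omega>d\<close> have finite measure with \<open>u\<close> bounded on \<open>E\<close>, and let \<open>f\<close> be the unit
  vector proportional to \<open>\<bar>u\<bar>\<close> to the power \<open>r / p\<close> on \<open>E\<close>, which attains equality in Hoelder's
  inequality. Diffuseness yields a Rademacher system \<open>e n\<close> on \<open>E\<close>, and \<open>e n * f\<close> has the same norms
  as \<open>f\<close> before and after multiplication by \<open>u\<close>. For compact \<open>K\<close> some subsequence of
  \<open>K (e n * f)\<close> converges; the averages of the corresponding \<open>e n * f\<close> tend to \<open>0\<close> in \<open>L\<^sup>p\<close> by
  orthogonality, so the limit is \<open>0\<close> and \<open>K\<close> does not help. Let \<open>E\<close> exhaust \<open>\<Omega>d\<close>.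
\<close>

section \<open>The \<open>L\<^sup>p\<close> norm\<close>

text \<open>Convexity of the power function on the positive reals extends to the endpoint 0: if one
  argument vanishes, the claim reduces to \<open>t powr q \<le> t\<close> for \<open>t\<close>
  between 0 and 1.\<close>

lemma powr_convex_nonneg:
  fixes a b l q :: real
  assumes "0 \<le> a" "0 \<le> b" "0 \<le> l" "l \<le> 1" "1 \<le> q"
  shows "(l * a + (1 - l) * b) powr q \<le> l * a powr q + (1 - l) * b powr q"
proof -
  have contract: "(t * c) powr q \<le> t * c powr q" if "0 \<le> t" "t \<le> 1" "0 \<le> c" for t c :: real
  proof -
    have "t powr q \<le> t" 
      using powr_mono'[of 1 q t] that assms by (cases "t = 0") auto
    then show ?thesis using that by (simp add: powr_mult mult_right_mono)
  qed
  show ?thesis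
  proof (cases "a = 0 \<or> b = 0")
    case True
    then show ?thesis using contract[of l a] contract[of "1 - l" b] assms by auto
  next
    case False
    with assms have "a \<in> {0<..}" "b \<in> {0<..}" by auto
    from convex_onD[OF powr_convex[OF \<open>1 \<le> q\<close>], of "1 - l", OF _ _ this] assms
    show ?thesis by simp
  qed
qed

lemma Lp_measurable: "f \<in> Lp M p \<Longrightarrow> f \<in> borel_measurable M"
  by (simp add: Lp_def)

lemma Lp_norm_nonneg [simp]: "0 \<le> Lp_norm M p f"
  by (simp add: Lp_norm_def)

lemma Lp_norm_powr: "0 < p \<Longrightarrow> Lp_norm M p f powr p = (\<integral>x. norm (f x) powr p \<partial>M)"
  by (simp add: Lp_norm_def powr_powr)

lemma Lp_norm_cong_AE:
  assumes [measurable]: "f \<in> borel_measurable M" "g \<in> borel_measurable M"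
    and "AE x in M. f x = g x"
  shows "Lp_norm M p f = Lp_norm M p g"
proof -
  have "(\<integral>x. norm (f x) powr p \<partial>M) = (\<integral>x. norm (g x) powr p \<partial>M)"
    using assms(3) by (intro integral_cong_AE) auto
  then show ?thesis by (simp add: Lp_norm_def)
qed

section \<open>Closure of \<open>Lp\<close> under domination and linear combinations\<close>

lemma Lp_dominated:
  assumes "f \<in> borel_measurable M" "g \<in> Lp M p" "AE x in M. norm (f x) \<le> norm (g x)" "0 \<le> p"
  shows "f \<in> Lp M p"
proof -
  have [measurable]: "f \<in> borel_measurable M" and g: "integrable M (\<lambda>x. norm (g x) powr p)"
    using assms by (auto simp: Lp_def)
  have "integrable M (\<lambda>x. norm (f x) powr p)"
  proof (rule Bochner_Integration.integrable_bound[OF g])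
    show "AE x in M. norm (norm (f x) powr p) \<le> norm (norm (g x) powr p)"
      using assms(3) by eventually_elim (simp add: powr_mono2 \<open>0 \<le> p\<close>)
  qed measurable
  then show ?thesis by (simp add: Lp_def)
qed

lemma Lp_cmult: "f \<in> Lp M p \<Longrightarrow> (\<lambda>x. c * f x) \<in> Lp M p"
  by (auto simp: Lp_def norm_mult powr_mult)

lemma Lp_norm_cmult: "0 < p \<Longrightarrow> Lp_norm M p (\<lambda>x. c * f x) = norm c * Lp_norm M p f"
  by (simp add: Lp_norm_def norm_mult powr_mult powr_powr)

lemma Lp_norm_diff_commute: "Lp_norm M p (\<lambda>x. f x - g x) = Lp_norm M p (\<lambda>x. g x - f x)"
  by (simp add: Lp_norm_def norm_minus_commute)

lemma Lp_add:
  assumes f: "f \<in> Lp M p" and g: "g \<in> Lp M p" and "0 \<le> p"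
  shows "(\<lambda>x. f x + g x) \<in> Lp M p"
proof -
  have [measurable]: "f \<in> borel_measurable M" "g \<in> borel_measurable M"
    using f g by (auto simp: Lp_def)
  \<comment> \<open>Bounding by twice the larger norm needs only \<open>0 \<le> p\<close>, whereas
    convexity would restrict closure under sums to exponents at least 1.\<close>
  have le: "norm (a + b) powr p \<le> 2 powr p * (norm a powr p + norm b powr p)" for a b :: complex
  proof -
    have "norm (a + b) powr p \<le> (2 * max (norm a) (norm b)) powr p"
      using norm_triangle_ineq[of a b] \<open>0 \<le> p\<close> by (intro powr_mono2) (auto simp: max_def)
    also have "\<dots> = 2 powr p * max (norm a) (norm b) powr p"
      by (simp add: powr_mult)
    also have "\<dots> \<le> 2 powr p * (norm a powr p + norm b powr p)"
      by (intro mult_left_mono) (auto simp: max_def)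
    finally show ?thesis .
  qed
  have "integrable M (\<lambda>x. norm (f x + g x) powr p)"
  proof (rule Bochner_Integration.integrable_bound)
    show "integrable M (\<lambda>x. 2 powr p * (norm (f x) powr p + norm (g x) powr p))"
      using f g by (simp add: Lp_def)
    show "AE x in M. norm (norm (f x + g x) powr p)
        \<le> norm (2 powr p * (norm (f x) powr p + norm (g x) powr p))"
      using le by (intro AE_I2) (smt (verit) powr_ge_zero real_norm_def)
  qed measurable
  then show ?thesis by (simp add: Lp_def)
qed

lemma Lp_diff:
  assumes "f \<in> Lp M p" "g \<in> Lp M p" "0 \<le> p"
  shows "(\<lambda>x. f x - g x) \<in> Lp M p"
  using Lp_add[OF assms(1) Lp_cmult[OF assms(2), of "-1"] assms(3)] by simp

lemma zero_mem_Lp [simp]: "(\<lambda>x. 0) \<in> Lp M p"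
  by (simp add: Lp_def)

lemma Lp_norm_zero [simp]: "Lp_norm M p (\<lambda>x. 0) = 0"
  by (simp add: Lp_norm_def)

lemma Lp_sum:
  assumes "\<And>i. i \<in> I \<Longrightarrow> f i \<in> Lp M p" "0 \<le> p"
  shows "(\<lambda>x. \<Sum>i\<in>I. f i x) \<in> Lp M p"
  using assms by (induction I rule: infinite_finite_induct) (auto intro: Lp_add)

lemma Lp_norm_eq_0_AE:
  assumes "f \<in> Lp M p" "0 < p" "Lp_norm M p f = 0"
  shows "AE x in M. f x = 0"
proof -
  have "(\<integral>x. norm (f x) powr p \<partial>M) = 0"
    using assms by (simp flip: Lp_norm_powr)
  then have "AE x in M. norm (f x) powr p = 0"
    using assms by (subst (asm) integral_nonneg_eq_0_iff_AE) (auto simp: Lp_def)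
  then show ?thesis by eventually_elim auto
qed

section \<open>The inequalities of Minkowski and Hoelder\<close>

text \<open>Minkowski's inequality by convexity. With \<open>a\<close> and \<open>b\<close> the two
  norms, \<open>norm (f x) + norm (g x)\<close> is \<open>a + b\<close> times the convex combination
  of the normalised values \<open>norm (f x) / a\<close> and \<open>norm (g x) / b\<close> with
  weights \<open>a / (a + b)\<close> and \<open>b / (a + b)\<close>. Both normalised functions have
  \<open>p\<close>-th power integral 1. Vanishing norms are split off because of the
  division.\<close>

lemma Lp_norm_triangle:
  assumes f: "f \<in> Lp M p" and g: "g \<in> Lp M p" and p: "1 \<le> p"
  shows "Lp_norm M p (\<lambda>x. f x + g x) \<le> Lp_norm M p f + Lp_norm M p g"
proof -
  have fm[measurable]: "f \<in> borel_measurable M" and gm[measurable]: "g \<in> borel_measurable M"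
    using f g by (auto simp: Lp_def)
  define a b where "a = Lp_norm M p f" and "b = Lp_norm M p g"
  have ab: "0 \<le> a" "0 \<le> b" by (simp_all add: a_def b_def)
  consider "a = 0" | "b = 0" | "0 < a" "0 < b" using ab by force
  then show ?thesis
  proof cases
    case 1
    then have "AE x in M. f x = 0" using Lp_norm_eq_0_AE[OF f] p by (simp add: a_def)
    then have "AE x in M. f x + g x = g x" by eventually_elim simp
    then show ?thesis using ab Lp_norm_cong_AE[of "\<lambda>x. f x + g x" M g p] by (simp add: a_def)
  next
    case 2
    then have "AE x in M. g x = 0" using Lp_norm_eq_0_AE[OF g] p by (simp add: b_def)
    then have "AE x in M. f x + g x = f x" by eventually_elim simp
    then show ?thesis using ab Lp_norm_cong_AE[of "\<lambda>x. f x + g x" M f p] by (simp add: b_def)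
  next
    case 3
    define l where "l = a / (a + b)"
    have l: "0 \<le> l" "l \<le> 1" "1 - l = b / (a + b)" using 3 by (auto simp: l_def field_simps)
    have le: "norm (f x + g x) powr p \<le> (a + b) powr p *
        (l / a powr p * norm (f x) powr p + (1 - l) / b powr p * norm (g x) powr p)" for x
    proof -
      have eq: "(a + b) * (l * (norm (f x) / a) + (1 - l) * (norm (g x) / b)) = norm (f x) + norm (g x)"
        using 3 unfolding l(3) by (simp add: l_def distrib_left)
      have "norm (f x + g x) powr p \<le> (norm (f x) + norm (g x)) powr p"
        using p by (intro powr_mono2 norm_triangle_ineq) auto
      also have "\<dots> = (a + b) powr p * (l * (norm (f x) / a) + (1 - l) * (norm (g x) / b)) powr p"
        using 3 l by (subst eq[symmetric]) (simp add: powr_mult)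
      also have "\<dots> \<le> (a + b) powr p *
          (l * (norm (f x) / a) powr p + (1 - l) * (norm (g x) / b) powr p)"
        using 3 l p by (intro mult_left_mono powr_convex_nonneg) auto
      finally show ?thesis using 3 by (simp add: powr_divide)
    qed
    have int: "integrable M (\<lambda>x. norm (f x) powr p)" "integrable M (\<lambda>x. norm (g x) powr p)"
      using f g by (auto simp: Lp_def)
    have "(\<integral>x. norm (f x + g x) powr p \<partial>M) \<le> (\<integral>x. (a + b) powr p *
        (l / a powr p * norm (f x) powr p + (1 - l) / b powr p * norm (g x) powr p) \<partial>M)"
      using int Lp_add[OF f g] p le by (intro integral_mono) (auto simp: Lp_def)
    also have "\<dots> = (a + b) powr p * (l / a powr p * a powr p + (1 - l) / b powr p * b powr p)"
      using int p by (simp add: a_def b_def Lp_norm_powr)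
    also have "\<dots> = (a + b) powr p" using 3 by simp
    finally have "Lp_norm M p (\<lambda>x. f x + g x) \<le> ((a + b) powr p) powr (1 / p)"
      unfolding Lp_norm_def using p by (intro powr_mono2) auto
    also have "\<dots> = a + b" using 3 p by (simp add: powr_powr)
    finally show ?thesis by (simp add: a_def b_def)
  qed
qed

lemma Lp_norm_triangle_sub:
  assumes "f \<in> Lp M p" "g \<in> Lp M p" "1 \<le> p"
  shows "Lp_norm M p f \<le> Lp_norm M p (\<lambda>x. f x - g x) + Lp_norm M p g"
  using Lp_norm_triangle[OF Lp_diff[OF assms(1,2)] assms(2,3)] assms(3) by simp

lemma Lp_norm_sum_le:
  assumes "finite I" "\<And>i. i \<in> I \<Longrightarrow> f i \<in> Lp M p" "1 \<le> p"
  shows "Lp_norm M p (\<lambda>x. \<Sum>i\<in>I. f i x) \<le> (\<Sum>i\<in>I. Lp_norm M p (f i))"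
  using assms
proof (induction I rule: finite_induct)
  case (insert i I)
  have "Lp_norm M p (\<lambda>x. f i x + (\<Sum>i\<in>I. f i x)) \<le> Lp_norm M p (f i) + Lp_norm M p (\<lambda>x. \<Sum>i\<in>I. f i x)"
    using insert by (intro Lp_norm_triangle Lp_sum) auto
  then show ?case using insert by force
qed simp

text \<open>After normalising both factors, Young's inequality is applied pointwise to their
  \<open>q\<close>-th powers and then integrated. This sharp constant, not just boundedness, is what
  the upper bound for the essential norm needs.\<close>

lemma Lp_norm_Holder:
  fixes p q r :: real
  assumes pq: "1 \<le> q" "q < p" "r = p * q / (p - q)"
    and u: "u \<in> Lp M r" and f: "f \<in> Lp M p"
  shows "Lp_norm M q (\<lambda>x. u x * f x) \<le> Lp_norm M r u * Lp_norm M p f"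
proof -
  have pos: "p > 0" "q > 0" "r > 0" using pq by auto
  have mem: "(\<lambda>x. u x * f x) \<in> Lp M q"
    using Lp_bounded_multiplication_operator[OF pq u] f
    by (simp add: Lp_bounded_operator_def multiplication_operator_def)
  have um[measurable]: "u \<in> borel_measurable M" and fm[measurable]: "f \<in> borel_measurable M"
    using u f by (auto simp: Lp_def)
  define a b where "a = Lp_norm M r u" and "b = Lp_norm M p f"
  have ab: "0 \<le> a" "0 \<le> b" by (simp_all add: a_def b_def)
  consider "a = 0 \<or> b = 0" | "0 < a" "0 < b" using ab by force
  then show ?thesis
  proof cases
    case 1
    then have "(AE x in M. u x = 0) \<or> (AE x in M. f x = 0)"
      using Lp_norm_eq_0_AE[OF u] Lp_norm_eq_0_AE[OF f] pos by (auto simp: a_def b_def)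
    then have "AE x in M. u x * f x = 0"
      by (auto elim: eventually_mono)
    then have "Lp_norm M q (\<lambda>x. u x * f x) = Lp_norm M q (\<lambda>x. 0)"
      by (intro Lp_norm_cong_AE) auto
    then show ?thesis by simp
  next
    case 2
    \<comment> \<open>The relation between \<open>r\<close>, \<open>p\<close> and \<open>q\<close>
      says exactly that \<open>r / q\<close> and \<open>p / q\<close> are conjugate
      exponents.\<close>
    have "q / r = (p - q) / p" using pq pos by simp
    then have conj: "q / r + q / p = 1" using pos by (simp add: diff_divide_distrib)
    have "r / q = p / (p - q)" using pq by simp
    then have exps: "1 < r / q" "1 < p / q" using pq by auto
    have le: "norm (u x * f x) powr q \<le> (a * b) powr q *
        (q / r / a powr r * norm (u x) powr r + q / p / b powr p * norm (f x) powr p)" for x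
    proof -
      have "norm (u x * f x) powr q = (a * b) powr q * ((norm (u x) / a) powr q * (norm (f x) / b) powr q)"
        using 2 by (simp add: norm_mult powr_mult powr_divide)
      also have "(norm (u x) / a) powr q * (norm (f x) / b) powr q \<le>
          ((norm (u x) / a) powr q) powr (r / q) / (r / q) + ((norm (f x) / b) powr q) powr (p / q) / (p / q)"
        using 2 pos conj exps by (intro Youngs_inequality) auto
      also have "\<dots> = q / r / a powr r * norm (u x) powr r + q / p / b powr p * norm (f x) powr p"
        using 2 pos by (simp add: powr_powr powr_divide mult.commute)
      finally show ?thesis by (simp add: mult_left_mono)
    qed
    have int: "integrable M (\<lambda>x. norm (u x) powr r)" "integrable M (\<lambda>x. norm (f x) powr p)"
      using u f by (auto simp: Lp_def)
    have "(\<integral>x. norm (u x * f x) powr q \<partial>M) \<le> (\<integral>x. (a * b) powr q *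
        (q / r / a powr r * norm (u x) powr r + q / p / b powr p * norm (f x) powr p) \<partial>M)"
      using int mem le by (intro integral_mono) (auto simp: Lp_def)
    also have "\<dots> = (a * b) powr q * (q / r / a powr r * a powr r + q / p / b powr p * b powr p)"
      using int pos by (simp add: a_def b_def Lp_norm_powr)
    also have "\<dots> = (a * b) powr q" using 2 conj by simp
    finally have "Lp_norm M q (\<lambda>x. u x * f x) \<le> ((a * b) powr q) powr (1 / q)"
      unfolding Lp_norm_def using pos by (intro powr_mono2) auto
    also have "\<dots> = a * b" using 2 pos by (simp add: powr_powr)
    finally show ?thesis by (simp add: a_def b_def)
  qed
qed

section \<open>Bounded and compact operators\<close>

lemma Lp_bounded_operatorD:
  assumes "Lp_bounded_operator M p q T"
  shows "f \<in> Lp M p \<Longrightarrow> T f \<in> Lp M q"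
    and "f \<in> Lp M p \<Longrightarrow> g \<in> Lp M p \<Longrightarrow> AE x in M. f x = g x \<Longrightarrow> AE x in M. T f x = T g x"
    and "f \<in> Lp M p \<Longrightarrow> g \<in> Lp M p \<Longrightarrow> AE x in M. T (\<lambda>y. f y + g y) x = T f x + T g x"
    and "f \<in> Lp M p \<Longrightarrow> AE x in M. T (\<lambda>y. c * f y) x = c * T f x"
  using assms by (auto simp: Lp_bounded_operator_def)

lemma Lp_bounded_operatorE:
  assumes "Lp_bounded_operator M p q T"
  obtains C where "0 \<le> C" "\<And>f. f \<in> Lp M p \<Longrightarrow> Lp_norm M q (T f) \<le> C * Lp_norm M p f"
proof -
  obtain C where C: "\<And>f. f \<in> Lp M p \<Longrightarrow> Lp_norm M q (T f) \<le> C * Lp_norm M p f"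
    using assms unfolding Lp_bounded_operator_def by blast
  have "Lp_norm M q (T f) \<le> \<bar>C\<bar> * Lp_norm M p f" if "f \<in> Lp M p" for f
    using C[OF that] mult_right_mono[of C "\<bar>C\<bar>" "Lp_norm M p f"] by (auto intro: order_trans)
  then show thesis using that[of "\<bar>C\<bar>"] by simp
qed

lemma Lp_bounded_operator_add:
  assumes S: "Lp_bounded_operator M p q S" and T: "Lp_bounded_operator M p q T" and q: "1 \<le> q"
  shows "Lp_bounded_operator M p q (\<lambda>f x. S f x + T f x)"
proof -
  obtain C where C: "\<And>f. f \<in> Lp M p \<Longrightarrow> Lp_norm M q (S f) \<le> C * Lp_norm M p f"
    using Lp_bounded_operatorE[OF S] by metis
  obtain D where D: "\<And>f. f \<in> Lp M p \<Longrightarrow> Lp_norm M q (T f) \<le> D * Lp_norm M p f"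
    using Lp_bounded_operatorE[OF T] by metis
  note S' = Lp_bounded_operatorD[OF S] and T' = Lp_bounded_operatorD[OF T]
  have bound: "\<exists>B. \<forall>f\<in>Lp M p. Lp_norm M q (\<lambda>x. S f x + T f x) \<le> B * Lp_norm M p f"
  proof (intro exI ballI)
    fix f assume f: "f \<in> Lp M p"
    show "Lp_norm M q (\<lambda>x. S f x + T f x) \<le> (C + D) * Lp_norm M p f"
      using Lp_norm_triangle[OF S'(1)[OF f] T'(1)[OF f] q] C[OF f] D[OF f]
      by (simp add: distrib_right)
  qed
  have cong: "AE x in M. S f x + T f x = S g x + T g x"
    if fg: "f \<in> Lp M p" "g \<in> Lp M p" "AE x in M. f x = g x" for f g
    using S'(2)[OF fg] T'(2)[OF fg] by eventually_elim simp
  have add: "AE x in M. S (\<lambda>y. f y + g y) x + T (\<lambda>y. f y + g y) x = S f x + T f x + (S g x + T g x)"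
    if fg: "f \<in> Lp M p" "g \<in> Lp M p" for f g
    using S'(3)[OF fg] T'(3)[OF fg] by eventually_elim simp
  have scale: "AE x in M. S (\<lambda>y. c * f y) x + T (\<lambda>y. c * f y) x = c * (S f x + T f x)"
    if f: "f \<in> Lp M p" for f c
    using S'(4)[OF f, of c] T'(4)[OF f, of c] by eventually_elim (simp add: distrib_left)
  have "(\<lambda>x. S f x + T f x) \<in> Lp M q" if "f \<in> Lp M p" for f
    using that q by (intro Lp_add S' T') auto
  then show ?thesis
    unfolding Lp_bounded_operator_def using bound cong add scale by blast
qed

lemma Lp_bounded_operator_uminus:
  assumes T: "Lp_bounded_operator M p q T"
  shows "Lp_bounded_operator M p q (\<lambda>f x. - T f x)"
proof -
  note T' = Lp_bounded_operatorD[OF T]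
  obtain C where C: "\<And>f. f \<in> Lp M p \<Longrightarrow> Lp_norm M q (T f) \<le> C * Lp_norm M p f"
    using Lp_bounded_operatorE[OF T] by metis
  have mem: "(\<lambda>x. - T f x) \<in> Lp M q" if "f \<in> Lp M p" for f
    using Lp_cmult[OF T'(1)[OF that], of "-1"] by simp
  have bound: "\<exists>B. \<forall>f\<in>Lp M p. Lp_norm M q (\<lambda>x. - T f x) \<le> B * Lp_norm M p f"
    using C by (auto simp: Lp_norm_def)
  have cong: "AE x in M. - T f x = - T g x"
    if fg: "f \<in> Lp M p" "g \<in> Lp M p" "AE x in M. f x = g x" for f g
    using T'(2)[OF fg] by simp
  have add: "AE x in M. - T (\<lambda>y. f y + g y) x = - T f x + - T g x"
    if fg: "f \<in> Lp M p" "g \<in> Lp M p" for f g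
    using T'(3)[OF fg] by eventually_elim simp
  have scale: "AE x in M. - T (\<lambda>y. c * f y) x = c * - T f x" if f: "f \<in> Lp M p" for f c
    using T'(4)[OF f, of c] by eventually_elim simp
  show ?thesis
    unfolding Lp_bounded_operator_def using mem bound cong add scale by blast
qed

lemma Lp_bounded_operator_diff:
  assumes "Lp_bounded_operator M p q S" "Lp_bounded_operator M p q T" "1 \<le> q"
  shows "Lp_bounded_operator M p q (\<lambda>f x. S f x - T f x)"
  using Lp_bounded_operator_add[OF assms(1) Lp_bounded_operator_uminus[OF assms(2)] assms(3)]
  by simp

section \<open>Operator norm and essential norm as real supremum and infimum\<close>

lemma Lp_norm_le_operator_norm:
  assumes "Lp_bounded_operator M p q T" "f \<in> Lp M p" "Lp_norm M p f \<le> 1"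
  shows "Lp_norm M q (T f) \<le> Lp_operator_norm M p q T"
  unfolding Lp_operator_norm_def
  using assms by (intro cSUP_upper Lp_operator_norm_bdd_above) auto

lemma Lp_operator_norm_nonneg:
  assumes "Lp_bounded_operator M p q T"
  shows "0 \<le> Lp_operator_norm M p q T"
  using Lp_norm_le_operator_norm[OF assms zero_mem_Lp] Lp_norm_nonneg[of M q "T (\<lambda>x. 0)"]
  by (simp del: Lp_norm_nonneg)

text \<open>An upper bound controls a real supremum only over a nonempty set; the zero function
  supplies a member of the unit ball.\<close>

lemma Lp_operator_norm_le:
  assumes "\<And>f. f \<in> Lp M p \<Longrightarrow> Lp_norm M p f \<le> 1 \<Longrightarrow> Lp_norm M q (T f) \<le> B"
  shows "Lp_operator_norm M p q T \<le> B"
  unfolding Lp_operator_norm_def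
proof (rule cSUP_least)
  have "(\<lambda>x. 0) \<in> {f \<in> Lp M p. Lp_norm M p f \<le> 1}" by simp
  then show "{f \<in> Lp M p. Lp_norm M p f \<le> 1} \<noteq> {}" by blast
qed (use assms in auto)

lemma Lp_compact_operator_imp_bounded:
  "Lp_compact_operator M p q K \<Longrightarrow> Lp_bounded_operator M p q K"
  by (simp add: Lp_compact_operator_def)

lemma Lp_compact_operatorE:
  assumes "Lp_compact_operator M p q K" "\<And>n. f n \<in> Lp M p" "\<And>n. Lp_norm M p (f n) \<le> C"
  obtains s g where "strict_mono (s :: nat \<Rightarrow> nat)" "g \<in> Lp M q"
    "(\<lambda>n. Lp_norm M q (\<lambda>x. K (f (s n)) x - g x)) \<longlonglongrightarrow> 0"
proof -
  have "(\<forall>n. f n \<in> Lp M p) \<and> (\<exists>C. \<forall>n. Lp_norm M p (f n) \<le> C)"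
    using assms by blast
  then show thesis
    using assms(1) that unfolding Lp_compact_operator_def by blast
qed

text \<open>A real infimum lies below its members only if the set is bounded below. Here 0 is a
  lower bound: each difference \<open>T - K\<close> is bounded, so its operator norm is a genuine
  supremum and nonnegative.\<close>

lemma Lp_essential_norm_le:
  assumes T: "Lp_bounded_operator M p q T" and K: "Lp_compact_operator M p q K" and q: "1 \<le> q"
  shows "Lp_essential_norm M p q T \<le> Lp_operator_norm M p q (\<lambda>f x. T f x - K f x)"
  unfolding Lp_essential_norm_def
proof (rule cINF_lower)
  show "bdd_below ((\<lambda>K. Lp_operator_norm M p q (\<lambda>f x. T f x - K f x)) ` {K. Lp_compact_operator M p q K})"
    using T q
    by (intro bdd_belowI[of _ 0])
      (auto intro!: Lp_operator_norm_nonneg Lp_bounded_operator_diff dest: Lp_compact_operator_imp_bounded)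
qed (use K in auto)

lemma Lp_essential_norm_ge:
  assumes "\<And>K. Lp_compact_operator M p q K \<Longrightarrow> B \<le> Lp_operator_norm M p q (\<lambda>f x. T f x - K f x)"
  shows "B \<le> Lp_essential_norm M p q T"
  unfolding Lp_essential_norm_def
  using assms zero_Lp_compact_operator by (intro cINF_greatest) blast+

text \<open>First pass to a subsequence along which the images under \<open>S\<close> converge, then
  to a further subsequence for \<open>T\<close>; the triangle inequality adds the limits. This
  carries compactness from one atom to finitely many.\<close>

lemma Lp_compact_operator_add:
  assumes S: "Lp_compact_operator M p q S" and T: "Lp_compact_operator M p q T" and q: "1 \<le> q"
  shows "Lp_compact_operator M p q (\<lambda>f x. S f x + T f x)"
  unfolding Lp_compact_operator_def
proof (intro conjI allI impI)
  note S' = Lp_compact_operator_imp_bounded[OF S] and T' = Lp_compact_operator_imp_bounded[OF T]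
  show "Lp_bounded_operator M p q (\<lambda>f x. S f x + T f x)"
    using S' T' q by (rule Lp_bounded_operator_add)
  fix f :: "nat \<Rightarrow> 'a \<Rightarrow> complex"
  assume "(\<forall>n. f n \<in> Lp M p) \<and> (\<exists>C. \<forall>n. Lp_norm M p (f n) \<le> C)"
  then obtain C where f: "\<And>n. f n \<in> Lp M p" and C: "\<And>n. Lp_norm M p (f n) \<le> C" by blast
  obtain s g where s: "strict_mono s" "g \<in> Lp M q"
      "(\<lambda>n. Lp_norm M q (\<lambda>x. S (f (s n)) x - g x)) \<longlonglongrightarrow> 0"
    by (rule Lp_compact_operatorE[OF S f C])
  obtain t h where t: "strict_mono t" "h \<in> Lp M q"
      "(\<lambda>n. Lp_norm M q (\<lambda>x. T (f (s (t n))) x - h x)) \<longlonglongrightarrow> 0"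
    by (rule Lp_compact_operatorE[of M p q T "\<lambda>n. f (s n)", OF T f C])
  have "(\<lambda>n. Lp_norm M q (\<lambda>x. S (f (s (t n))) x - g x) + Lp_norm M q (\<lambda>x. T (f (s (t n))) x - h x))
      \<longlonglongrightarrow> 0 + 0"
    using LIMSEQ_subseq_LIMSEQ[OF s(3) t(1)] t(3) by (intro tendsto_add) (simp_all add: o_def)
  then have lim: "(\<lambda>n. Lp_norm M q (\<lambda>x. S (f (s (t n))) x - g x) +
      Lp_norm M q (\<lambda>x. T (f (s (t n))) x - h x)) \<longlonglongrightarrow> 0" by simp
  have le: "Lp_norm M q (\<lambda>x. S (f (s (t n))) x + T (f (s (t n))) x - (g x + h x))
      \<le> Lp_norm M q (\<lambda>x. S (f (s (t n))) x - g x) + Lp_norm M q (\<lambda>x. T (f (s (t n))) x - h x)" for n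
  proof -
    have "Lp_norm M q (\<lambda>x. (S (f (s (t n))) x - g x) + (T (f (s (t n))) x - h x))
      \<le> Lp_norm M q (\<lambda>x. S (f (s (t n))) x - g x) + Lp_norm M q (\<lambda>x. T (f (s (t n))) x - h x)"
      using s t f q S' T' by (intro Lp_norm_triangle Lp_diff) (auto intro: Lp_bounded_operatorD)
    then show ?thesis by (simp add: algebra_simps)
  qed
  have "(\<lambda>n. Lp_norm M q (\<lambda>x. S (f (s (t n))) x + T (f (s (t n))) x - (g x + h x))) \<longlonglongrightarrow> 0"
    by (rule Lim_null_comparison[OF _ lim]) (simp add: le)
  moreover have "strict_mono (\<lambda>n. s (t n))" "(\<lambda>x. g x + h x) \<in> Lp M q"
    using s t q strict_mono_o[of s t] by (auto simp: o_def intro: Lp_add)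
  ultimately show "\<exists>s g. strict_mono s \<and> g \<in> Lp M q \<and>
      (\<lambda>n. Lp_norm M q (\<lambda>x. S (f (s n)) x + T (f (s n)) x - g x)) \<longlonglongrightarrow> 0"
    by (intro exI[of _ "\<lambda>n. s (t n)"] exI[of _ "\<lambda>x. g x + h x"]) simp
qed

section \<open>Atoms\<close>

text \<open>By sigma-finiteness a set of infinite measure contains a subset of finite positive
  measure, which an atom cannot have.\<close>

lemma (in sigma_finite_measure) emeasure_atom_finite:
  assumes "measure_atom M A"
  shows "emeasure M A \<noteq> \<infinity>"
proof
  assume inf: "emeasure M A = \<infinity>"
  have A[measurable]: "A \<in> sets M" using assms by (simp add: measure_atom_def)
  obtain Z where "Z \<in> sets M" "Z \<subseteq> A" "emeasure M Z < \<infinity>" "emeasure M Z > (0::real)"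
    using approx_PInf_emeasure_with_finite[OF A inf, of 0] by (metis ennreal_0)
  moreover from this have "emeasure M Z = 0 \<or> emeasure M Z = emeasure M A"
    using assms by (simp add: measure_atom_def)
  ultimately show False using inf by auto
qed

text \<open>For each basic open \<open>U\<close>, the part of \<open>A\<close> that \<open>f\<close>
  maps into \<open>U\<close> has measure 0 or that of \<open>A\<close>. Countably many null parts
  can be discarded together. If two remaining points had different values, disjoint basic
  neighbourhoods of these values would give two disjoint parts of full measure, which forces the
  finite measure of \<open>A\<close> to be 0 and contradicts that these parts are not null.\<close>

lemma measure_atom_AE_const:
  fixes f :: "'a \<Rightarrow> 'b :: {second_countable_topology, t2_space}"
  assumes atom: "measure_atom M A" and fin: "emeasure M A \<noteq> \<infinity>"
    and f[measurable]: "f \<in> borel_measurable M"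
  shows "\<exists>c. AE x in M. x \<in> A \<longrightarrow> f x = c"
proof -
  have [measurable]: "A \<in> sets M" using atom by (simp add: measure_atom_def)
  obtain B :: "'b set set" where B: "countable B" "topological_basis B"
    using ex_countable_basis by blast
  have [measurable]: "U \<in> sets borel" if "U \<in> B" for U
    using topological_basis_open[OF B(2) that] by simp
  have sets: "{x\<in>A. f x \<in> U} \<in> sets M" if "U \<in> B" for U
  proof -
    have "{x\<in>A. f x \<in> U} = {x\<in>space M. f x \<in> U} \<inter> A"
      using sets.sets_into_space[of A M] by auto
    also have "\<dots> \<in> sets M" using that by measurable
    finally show ?thesis .
  qed
  have full: "emeasure M {x\<in>A. f x \<in> U} = 0 \<or> emeasure M {x\<in>A. f x \<in> U} = emeasure M A"
    if "U \<in> B" for U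
    using atom sets[OF that] by (auto simp: measure_atom_def)
  have null_AE: "AE x in M. \<not> (x \<in> A \<and> f x \<in> U)" if "U \<in> B" "emeasure M {x\<in>A. f x \<in> U} = 0" for U
  proof (rule AE_I[of _ _ "{x\<in>space M. x \<in> A \<and> f x \<in> U}"])
    have "{x\<in>space M. x \<in> A \<and> f x \<in> U} = {x\<in>A. f x \<in> U}"
      using sets.sets_into_space[of A M] by auto
    then show "emeasure M {x\<in>space M. x \<in> A \<and> f x \<in> U} = 0" using that by simp
    show "{x\<in>space M. x \<in> A \<and> f x \<in> U} \<in> sets M" using that by measurable
  qed auto
  define N where "N = {U\<in>B. emeasure M {x\<in>A. f x \<in> U} = 0}"
  have "countable N" using B(1) by (simp add: N_def)
  moreover have "AE x in M. \<not> (x \<in> A \<and> f x \<in> U)" if "U \<in> N" for U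
    using that null_AE by (simp add: N_def)
  ultimately have ae: "AE x in M. \<forall>U\<in>N. \<not> (x \<in> A \<and> f x \<in> U)"
    by (subst AE_ball_countable) auto
  have same: "f x = f y"
    if x: "x \<in> A" "\<forall>U\<in>N. f x \<notin> U" and y: "y \<in> A" "\<forall>U\<in>N. f y \<notin> U" for x y
  proof (rule ccontr)
    assume "f x \<noteq> f y"
    then obtain V W where VW: "open V" "open W" "f x \<in> V" "f y \<in> W" "V \<inter> W = {}"
      using hausdorff[OF \<open>f x \<noteq> f y\<close>] by auto
    obtain V' where V': "V' \<in> B" "f x \<in> V'" "V' \<subseteq> V" using topological_basisE[OF B(2) VW(1,3)] .
    obtain W' where W': "W' \<in> B" "f y \<in> W'" "W' \<subseteq> W" using topological_basisE[OF B(2) VW(2,4)] .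
    have V'0: "emeasure M {x\<in>A. f x \<in> V'} \<noteq> 0" using V' x by (auto simp: N_def)
    have W'0: "emeasure M {x\<in>A. f x \<in> W'} \<noteq> 0" using W' y by (auto simp: N_def)
    have "emeasure M A + emeasure M A = emeasure M {x\<in>A. f x \<in> V'} + emeasure M {x\<in>A. f x \<in> W'}"
      using full[OF V'(1)] full[OF W'(1)] V'0 W'0 by simp
    also have "\<dots> = emeasure M ({x\<in>A. f x \<in> V'} \<union> {x\<in>A. f x \<in> W'})"
      using V' W' VW sets by (intro plus_emeasure) auto
    also have "\<dots> \<le> emeasure M A" by (intro emeasure_mono) auto
    \<comment> \<open>The summand 0 puts the inequality in the form in which the finite
      \<open>emeasure M A\<close> cancels on the left.\<close>
    finally have "emeasure M A + emeasure M A \<le> emeasure M A + 0" by simp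
    then have "emeasure M A = 0" using fin by (auto simp: ennreal_add_left_cancel_le)
    then show False using full[OF V'(1)] V'0 by simp
  qed
  show ?thesis
  proof (cases "\<exists>y\<in>A. \<forall>U\<in>N. f y \<notin> U")
    case True
    then obtain y where y: "y \<in> A" "\<forall>U\<in>N. f y \<notin> U" by blast
    from ae have "AE x in M. x \<in> A \<longrightarrow> f x = f y"
      by (rule eventually_mono) (use same[OF _ _ y] in simp)
    then show ?thesis by blast
  next
    case False
    \<comment> \<open>No point of \<open>A\<close> survives the removal, so almost every point lies
      outside \<open>A\<close> and any constant will do.\<close>
    from ae have "AE x in M. x \<in> A \<longrightarrow> f x = undefined"
      by (rule eventually_mono) (use False in auto)
    then show ?thesis by blast
  qed
qed

lemma indicator_mem_Lp:
  assumes "A \<in> sets M" "emeasure M A \<noteq> \<infinity>"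
  shows "(\<lambda>x. indicator A x) \<in> Lp M p"
proof -
  have "(\<lambda>x. norm (indicator A x :: complex) powr p) = (\<lambda>x. indicator A x)"
    by (auto simp: indicator_def)
  then show ?thesis using assms by (auto simp: Lp_def integrable_indicator_iff top.not_eq_extremum)
qed

lemma indicator_mult_mem_Lp:
  assumes "u \<in> Lp M p" "A \<in> sets M" "0 \<le> p"
  shows "(\<lambda>x. indicator A x * u x) \<in> Lp M p"
  by (rule Lp_dominated[of _ M u]) (use assms in \<open>auto simp: Lp_def indicator_def\<close>)

text \<open>Functions are almost everywhere constant on an atom, so this operator has rank at most
  one: its values are multiples of \<open>u\<close> restricted to \<open>A\<close>. A bounded
  sequence yields bounded constants, and a convergent subsequence of these gives convergence in the
  norm.\<close>

lemma Lp_compact_multiplication_atom: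
  fixes p q r :: real
  assumes pq: "1 \<le> q" "q < p" "r = p * q / (p - q)" and u: "u \<in> Lp M r"
    and atom: "measure_atom M A" and fin: "emeasure M A \<noteq> \<infinity>"
  shows "Lp_compact_operator M p q (multiplication_operator (\<lambda>x. indicator A x * u x))"
  unfolding Lp_compact_operator_def
proof (intro conjI allI impI)
  have A[measurable]: "A \<in> sets M" using atom by (simp add: measure_atom_def)
  have r: "0 \<le> r" using pq by simp
  let ?u = "\<lambda>x. indicator A x * u x"
  have u': "?u \<in> Lp M r" using u A r by (rule indicator_mult_mem_Lp)
  show bounded: "Lp_bounded_operator M p q (multiplication_operator ?u)"
    using pq u' by (rule Lp_bounded_multiplication_operator)
  \<comment> \<open>Finite measure puts the indicator of \<open>A\<close> in \<open>Lp M p\<close>,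
    and its image under the operator is \<open>?u\<close> itself.\<close>
  have v: "?u \<in> Lp M q"
  proof -
    have "multiplication_operator ?u (indicator A) \<in> Lp M q"
      using bounded indicator_mem_Lp[OF A fin] by (simp add: Lp_bounded_operator_def)
    moreover have "multiplication_operator ?u (indicator A) = ?u"
      by (auto simp: multiplication_operator_def indicator_def)
    ultimately show ?thesis by simp
  qed
  have vm[measurable]: "?u \<in> borel_measurable M" using v by (rule Lp_measurable)
  fix f :: "nat \<Rightarrow> 'a \<Rightarrow> complex"
  assume "(\<forall>n. f n \<in> Lp M p) \<and> (\<exists>C. \<forall>n. Lp_norm M p (f n) \<le> C)"
  then obtain C where f: "\<And>n. f n \<in> Lp M p" and C: "\<And>n. Lp_norm M p (f n) \<le> C" by blast
  have [measurable]: "f n \<in> borel_measurable M" for n using f by (rule Lp_measurable)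
  show "\<exists>s g. strict_mono s \<and> g \<in> Lp M q \<and>
      (\<lambda>n. Lp_norm M q (\<lambda>x. multiplication_operator ?u (f (s n)) x - g x)) \<longlonglongrightarrow> 0"
  proof (cases "emeasure M A = 0")
    \<comment> \<open>On a null atom the norms of the \<open>f n\<close> do not control the
      constants, but all images vanish almost everywhere.\<close>
    case True
    then have "AE x in M. x \<notin> A" by (intro AE_not_in null_setsI A)
    then have "AE x in M. multiplication_operator ?u (f n) x - 0 = 0" for n
      by eventually_elim (simp add: multiplication_operator_def)
    then have "Lp_norm M q (\<lambda>x. multiplication_operator ?u (f n) x - 0) = Lp_norm M q (\<lambda>x. 0)" for n
      by (intro Lp_norm_cong_AE) (auto simp: multiplication_operator_def[abs_def])
    then show ?thesis
      by (intro exI[of _ id] exI[of _ "\<lambda>x. 0"]) (auto simp: strict_mono_def)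
  next
    case False
    then have pos: "measure M A > 0"
      using fin by (simp add: measure_def enn2real_positive_iff top.not_eq_extremum zero_less_iff_neq_zero)
    have "\<exists>c. AE x in M. x \<in> A \<longrightarrow> f n x = c" for n
      by (intro measure_atom_AE_const[OF atom fin]) measurable
    then obtain c where c: "\<And>n. AE x in M. x \<in> A \<longrightarrow> f n x = c n"
      by metis
    have bd: "norm (c n) \<le> C / measure M A powr (1 / p)" for n
    proof -
      have "Lp_norm M p (\<lambda>x. c n * indicator A x) = Lp_norm M p (\<lambda>x. indicator A x * f n x)"
      proof (rule Lp_norm_cong_AE)
        show "AE x in M. c n * indicator A x = indicator A x * f n x"
          using c[of n] by eventually_elim (auto simp: indicator_def)
      qed measurable
      also have "\<dots> \<le> Lp_norm M p (f n)"
        using f[of n] indicator_mult_mem_Lp[OF f[of n] A] pq unfolding Lp_norm_def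
        by (intro powr_mono2 integral_mono) (auto simp: Lp_def indicator_def)
      also have "\<dots> \<le> C" by (rule C)
      finally have "norm (c n) * Lp_norm M p (indicator A) \<le> C"
        using pq by (simp add: Lp_norm_cmult)
      moreover have "Lp_norm M p (indicator A) = measure M A powr (1 / p)"
      proof -
        have "(\<lambda>x. norm (indicator A x :: complex) powr p) = indicator A"
          by (auto simp: indicator_def)
        then show ?thesis using A by (simp add: Lp_norm_def)
      qed
      ultimately show ?thesis using pos by (simp add: field_simps)
    qed
    have "bounded (range c)" using bd by (auto simp: bounded_iff)
    then obtain l s where s: "strict_mono s" "(c \<circ> s) \<longlonglongrightarrow> l"
      using bounded_imp_convergent_subsequence by blast
    have "Lp_norm M q (\<lambda>x. multiplication_operator ?u (f (s n)) x - l * ?u x) =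
        norm (c (s n) - l) * Lp_norm M q ?u" for n
    proof -
      have "Lp_norm M q (\<lambda>x. multiplication_operator ?u (f (s n)) x - l * ?u x) =
          Lp_norm M q (\<lambda>x. (c (s n) - l) * ?u x)"
      proof (rule Lp_norm_cong_AE)
        show "AE x in M. multiplication_operator ?u (f (s n)) x - l * ?u x = (c (s n) - l) * ?u x"
          using c[of "s n"]
          by eventually_elim (auto simp: indicator_def multiplication_operator_def algebra_simps)
      qed (unfold multiplication_operator_def, measurable)
      then show ?thesis using pq by (simp add: Lp_norm_cmult)
    qed
    moreover have "(\<lambda>n. norm (c (s n) - l) * Lp_norm M q ?u) \<longlonglongrightarrow> norm (l - l) * Lp_norm M q ?u"
      using s(2) by (intro tendsto_intros) (simp add: o_def)
    ultimately have "(\<lambda>n. Lp_norm M q (\<lambda>x. multiplication_operator ?u (f (s n)) x - l * ?u x)) \<longlonglongrightarrow> 0"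
      by simp
    then show ?thesis
      using s(1) Lp_cmult[OF v] by (intro exI[of _ s] exI[of _ "\<lambda>x. l * ?u x"] conjI)
  qed
qed

section \<open>Rademacher systems\<close>

text \<open>Pairwise orthogonality over \<open>E\<close> stands in for independence. The absolute
  value is 1 off \<open>E\<close> as well, so multiplication by \<open>e n\<close> preserves
  absolute values at every point.\<close>

definition rademacher_on :: "'a measure \<Rightarrow> 'a set \<Rightarrow> (nat \<Rightarrow> 'a \<Rightarrow> real) \<Rightarrow> bool" where
  "rademacher_on M E e \<longleftrightarrow>
     (\<forall>n. e n \<in> borel_measurable M) \<and> (\<forall>n x. \<bar>e n x\<bar> = 1) \<and>
     (\<forall>m n. m \<noteq> n \<longrightarrow> (LINT x:E|M. e m x * e n x) = 0)"

text \<open>\<open>halving_word H E n x\<close> records in which half of each of the first \<open>n\<close> successive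
  bisections by \<open>H\<close> the point \<open>x\<close> lies, the latest one first.\<close>

primrec halving_word :: "('a set \<Rightarrow> 'a set) \<Rightarrow> 'a set \<Rightarrow> nat \<Rightarrow> 'a \<Rightarrow> bool list" where
  "halving_word H E 0 x = []"
| "halving_word H E (Suc n) x =
     (x \<in> H {y\<in>E. halving_word H E n y = halving_word H E n x}) # halving_word H E n x"

lemma length_halving_word [simp]: "length (halving_word H E n x) = n"
  by (induction n) auto

text \<open>The latest bit stands at the head, so the word of an earlier stage is a suffix.\<close>

lemma drop_halving_word:
  "k \<le> n \<Longrightarrow> drop (n - k) (halving_word H E n x) = halving_word H E k x"
proof (induction n)
  case (Suc n)
  then show ?case by (cases "k = Suc n") (auto simp: Suc_diff_le)
qed simp

text \<open>Bisect \<open>E\<close> repeatedly and let \<open>e n\<close> be the sign telling the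
  two halves of each level \<open>n\<close> cell apart. For \<open>m < n\<close> the function
  \<open>e m\<close> is constant on every level \<open>n\<close> cell, while \<open>e n\<close> has
  integral 0 there, so the product integrates to 0 over \<open>E\<close>.\<close>

lemma exists_rademacher_on:
  assumes E: "E \<in> sets M" and fin: "emeasure M E \<noteq> \<infinity>"
    and half: "\<And>A. A \<in> sets M \<Longrightarrow> A \<subseteq> E \<Longrightarrow> \<exists>B\<in>sets M. B \<subseteq> A \<and> measure M B = measure M A / 2"
  shows "\<exists>e. rademacher_on M E e"
proof -
  have "\<exists>H. \<forall>A. A \<in> sets M \<and> A \<subseteq> E \<longrightarrow> H A \<in> sets M \<and> H A \<subseteq> A \<and> measure M (H A) = measure M A / 2"
    using half by (intro choice) blast
  then obtain H where H: "\<And>A. A \<in> sets M \<Longrightarrow> A \<subseteq> E \<Longrightarrow> H A \<in> sets M"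
      "\<And>A. A \<in> sets M \<Longrightarrow> A \<subseteq> E \<Longrightarrow> H A \<subseteq> A"
      "\<And>A. A \<in> sets M \<Longrightarrow> A \<subseteq> E \<Longrightarrow> measure M (H A) = measure M A / 2"
    by metis
  define \<phi> where "\<phi> = halving_word H E"
  define L where "L n w = {y\<in>E. \<phi> n y = w}" for n w
  define e :: "nat \<Rightarrow> 'a \<Rightarrow> real" where "e n x = (if x \<in> E \<and> hd (\<phi> (Suc n) x) then 1 else -1)" for n x
  define W where "W n = {w :: bool list. length w = n}" for n
  have finW: "finite (W n)" for n
    using finite_lists_length_eq[of "UNIV :: bool set" n] by (simp add: W_def)
  have \<phi>W: "\<phi> n x \<in> W n" for n x by (simp add: W_def \<phi>_def)
  have LE: "L n w \<subseteq> E" for n w by (auto simp: L_def)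
  have \<phi>_Suc: "\<phi> (Suc n) x = (x \<in> H (L n (\<phi> n x))) # \<phi> n x" for n x
    by (simp add: \<phi>_def L_def)
  have L_Suc: "L (Suc n) (b # w) = (if b then L n w \<inter> H (L n w) else L n w - H (L n w))" for n b w
    by (auto simp: L_def[of "Suc n"] \<phi>_Suc) (auto simp: L_def)
  have L_sets: "L n w \<in> sets M" for n w
  proof (induction n arbitrary: w)
    case 0
    then show ?case using E by (cases w) (auto simp: L_def \<phi>_def)
  next
    case (Suc n)
    show ?case
    proof (cases w)
      case Nil
      then show ?thesis by (simp add: L_def \<phi>_def)
    next
      case (Cons b v)
      then show ?thesis using Suc[of v] H(1)[OF Suc LE, of v] by (auto simp: L_Suc)
    qed
  qed
  have fin': "emeasure M A \<noteq> \<infinity>" if "A \<in> sets M" "A \<subseteq> E" for A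
    using emeasure_mono[of A E M] that E fin by (auto simp: top_unique)
  have balanced: "measure M (L (Suc n) (True # w)) = measure M (L (Suc n) (False # w))" for n w
  proof -
    note h = H[OF L_sets LE, of n w]
    have "measure M (L n w - H (L n w)) = measure M (L n w) - measure M (H (L n w))"
      using h L_sets LE by (intro measure_Diff fin') auto
    moreover have "L n w \<inter> H (L n w) = H (L n w)" using h by auto
    ultimately show ?thesis using h by (simp add: L_Suc)
  qed
  \<comment> \<open>Each sign is decided by membership in a finite union of measurable cells, which
    gives measurability; points off \<open>E\<close> lie in no cell and get -1.\<close>
  have e_eq: "e n x = (if x \<in> (\<Union>w\<in>W n. L (Suc n) (True # w)) then 1 else -1)" for n x
    using \<phi>W[of n x] by (auto simp: e_def L_def \<phi>_Suc)
  have meas: "e n \<in> borel_measurable M" for n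
  proof -
    have [measurable]: "(\<Union>w\<in>W n. L (Suc n) (True # w)) \<in> sets M"
      using finW L_sets by (intro sets.finite_UN) auto
    show ?thesis unfolding e_eq[abs_def] by measurable
  qed
  have orth: "(LINT x:E|M. e m x * e n x) = 0" if "m < n" for m n
  proof -
    \<comment> \<open>Dropping \<open>n - Suc m\<close> entries leaves the word after
      \<open>Suc m\<close> bisections, whose head is the bit that decides \<open>e m\<close>. Thus
      \<open>c\<close> reads the value of \<open>e m\<close> off the level \<open>n\<close>
      word.\<close>
    define c :: "bool list \<Rightarrow> real" where "c w = (if hd (drop (n - Suc m) w) then 1 else -1)" for w
    have em: "e m x = c (\<phi> n x)" if "x \<in> E" for x
      using that drop_halving_word[of "Suc m" n H E x] \<open>m < n\<close> by (simp add: e_def c_def \<phi>_def)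
    \<comment> \<open>Only the cell of \<open>x\<close> contributes to the sum, and its two halves
      carry the values 1 and -1 of \<open>e n\<close>.\<close>
    have pt: "indicator E x *\<^sub>R (e m x * e n x) =
        (\<Sum>w\<in>W n. c w * (indicator (L (Suc n) (True # w)) x - indicator (L (Suc n) (False # w)) x))" for x
    proof (cases "x \<in> E")
      case True
      have "(\<Sum>w\<in>W n. c w * (indicator (L (Suc n) (True # w)) x - indicator (L (Suc n) (False # w)) x))
          = (\<Sum>w\<in>W n. if w = \<phi> n x then c w * e n x else 0)"
        using True by (intro sum.cong) (auto simp: L_def[of "Suc n"] \<phi>_Suc e_def)
      then show ?thesis using True em[OF True] finW \<phi>W by simp
    next
      case False
      then show ?thesis by (simp add: L_def)
    qed
    have int: "integrable M (indicator (L (Suc n) w) :: 'a \<Rightarrow> real)" for w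
      using L_sets fin'[OF L_sets LE] by (simp add: integrable_indicator_iff top.not_eq_extremum)
    have "(LINT x:E|M. e m x * e n x) =
        (\<Sum>w\<in>W n. c w * (measure M (L (Suc n) (True # w)) - measure M (L (Suc n) (False # w))))"
      unfolding set_lebesgue_integral_def pt
      using int L_sets sets.sets_into_space[OF L_sets]
      by (subst Bochner_Integration.integral_sum) (auto simp: Int_absorb2)
    then show ?thesis by (simp add: balanced)
  qed
  have "rademacher_on M E e"
    unfolding rademacher_on_def
  proof (intro conjI allI impI)
    fix m n :: nat assume "m \<noteq> n"
    then consider "m < n" | "n < m" by linarith
    then show "(LINT x:E|M. e m x * e n x) = 0"
      using orth[of m n] orth[of n m] by cases (simp_all add: mult.commute)
  qed (auto simp: meas e_def)
  then show ?thesis by blast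
qed

lemma rademacher_onD:
  assumes "rademacher_on M E e"
  shows "e n \<in> borel_measurable M" "\<bar>e n x\<bar> = 1" "m \<noteq> n \<Longrightarrow> (LINT x:E|M. e m x * e n x) = 0"
  using assms by (auto simp: rademacher_on_def)

text \<open>Pythagoras: after expanding the square the mixed terms integrate to 0, since
  \<open>s\<close> keeps indices distinct, and each of the \<open>N\<close> diagonal terms
  contributes the measure of \<open>E\<close>.\<close>

lemma rademacher_on_sum_square:
  assumes e: "rademacher_on M E e" and E: "E \<in> sets M" and fin: "emeasure M E \<noteq> \<infinity>"
    and s: "inj s"
  shows "integrable M (\<lambda>x. indicator E x * (\<Sum>k<N. e (s k) x)\<^sup>2)"
    and "(\<integral>x. indicator E x * (\<Sum>k<N. e (s k) x)\<^sup>2 \<partial>M) = real N * measure M E"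
proof -
  note [measurable] = rademacher_onD(1)[OF e] E
  have indE: "integrable M (indicator E :: 'a \<Rightarrow> real)"
    using E fin by (simp add: integrable_indicator_iff top.not_eq_extremum)
  have int: "integrable M (\<lambda>x. indicator E x * (e m x * e n x))" for m n
    by (rule Bochner_Integration.integrable_bound[OF indE])
      (auto simp: abs_mult rademacher_onD(2)[OF e] indicator_def)
  have exp: "indicator E x * (\<Sum>k<N. e (s k) x)\<^sup>2 =
      (\<Sum>j<N. \<Sum>k<N. indicator E x * (e (s j) x * e (s k) x))" for x
    by (cases "x \<in> E") (simp_all add: power2_eq_square sum_product)
  show "integrable M (\<lambda>x. indicator E x * (\<Sum>k<N. e (s k) x)\<^sup>2)"
    unfolding exp by (intro Bochner_Integration.integrable_sum int)
  have val: "(\<integral>x. indicator E x * (e (s j) x * e (s k) x) \<partial>M) = (if j = k then measure M E else 0)" for j k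
  proof (cases "j = k")
    case True
    have "e n x * e n x = 1" for n x
      using rademacher_onD(2)[OF e, of n x] by (metis abs_mult_self_eq mult_1)
    then show ?thesis using True E sets.sets_into_space[OF E] by (simp add: Int_absorb2)
  next
    case False
    then have "s j \<noteq> s k" using s by (auto dest: injD)
    then show ?thesis using rademacher_onD(3)[OF e] False by (simp add: set_lebesgue_integral_def)
  qed
  show "(\<integral>x. indicator E x * (\<Sum>k<N. e (s k) x)\<^sup>2 \<partial>M) = real N * measure M E"
    unfolding exp
    by (subst Bochner_Integration.integral_sum, intro Bochner_Integration.integrable_sum int,
        subst Bochner_Integration.integral_sum, rule int) (simp add: val)
qed

text \<open>The averaged signs are bounded by 1 and their mean square over \<open>E\<close> is
  \<open>measure M E / real N\<close>. A Chebyshev-type splitting turns this into convergence of the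
  \<open>p\<close>-th power integrals for every positive \<open>p\<close>, treating exponents below
  and above 2 alike.\<close>

lemma rademacher_average_tendsto_0:
  fixes f :: "'a \<Rightarrow> complex"
  assumes e: "rademacher_on M E e" and E: "E \<in> sets M" and fin: "emeasure M E \<noteq> \<infinity>"
    and s: "inj s" and p: "0 < p"
    and f[measurable]: "f \<in> borel_measurable M" and C: "\<And>x. norm (f x) \<le> C * indicator E x"
  shows "(\<lambda>N. Lp_norm M p (\<lambda>x. (1 / of_nat N) * (\<Sum>k<N. e (s k) x * f x))) \<longlonglongrightarrow> 0"
proof -
  note [measurable] = rademacher_onD(1)[OF e] E
  have indE: "integrable M (indicator E :: 'a \<Rightarrow> real)"
    using E fin by (simp add: integrable_indicator_iff top.not_eq_extremum)
  let ?C = "\<bar>C\<bar>"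
  define a where "a N x = (\<Sum>k<N. e (s k) x) / real N" for N x
  have F: "(1 / of_nat N) * (\<Sum>k<N. e (s k) x * f x) = of_real (a N x) * f x" for N x
    by (simp add: a_def sum_distrib_right)
  have a1: "\<bar>a N x\<bar> \<le> 1" for N x
  proof -
    have "\<bar>\<Sum>k<N. e (s k) x\<bar> \<le> (\<Sum>k<N. \<bar>e (s k) x\<bar>)" by (rule sum_abs)
    also have "\<dots> = real N" by (simp add: rademacher_onD(2)[OF e])
    finally show ?thesis by (simp add: a_def divide_le_eq)
  qed
  \<comment> \<open>Split at the threshold \<open>real N powr (- 1 / 4)\<close>: below it the first
    summand suffices, above it the second is at least 1. The weight
    \<open>real N powr (1 / 2)\<close> is still small against the decay \<open>1 / N\<close> of the
    mean square.\<close>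
  have pt: "\<bar>a N x\<bar> powr p \<le> real N powr (- p / 4) + real N powr (1 / 2) * (a N x)\<^sup>2" if "N > 0" for N x
  proof (cases "\<bar>a N x\<bar> \<le> real N powr (- 1 / 4)")
    case True
    then have "\<bar>a N x\<bar> powr p \<le> (real N powr (- 1 / 4)) powr p"
      using p by (intro powr_mono2) auto
    then show ?thesis by (simp add: powr_powr add_increasing2)
  next
    case False
    have "\<bar>a N x\<bar> powr p \<le> 1 powr p" using p a1 by (intro powr_mono2) auto
    also have "\<dots> = real N powr (1 / 2) * (real N powr (- 1 / 4))\<^sup>2"
      using that by (simp add: power2_eq_square flip: powr_add)
    also have "\<dots> \<le> real N powr (1 / 2) * (a N x)\<^sup>2"
      using False by (intro mult_left_mono) (auto simp: abs_le_square_iff[symmetric])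
    finally show ?thesis by (simp add: add_increasing)
  qed
  have sq: "integrable M (\<lambda>x. indicator E x * (a N x)\<^sup>2)"
    "(\<integral>x. indicator E x * (a N x)\<^sup>2 \<partial>M) = measure M E / real N" if "N > 0" for N
    using rademacher_on_sum_square[OF e E fin s, of N] that
    by (simp_all add: a_def power_divide power2_eq_square[of "real N"])
  define b where "b N = ?C powr p * (real N powr (- p / 4) * measure M E +
      real N powr (1 / 2) * (measure M E / real N))" for N
  have le: "Lp_norm M p (\<lambda>x. (1 / of_nat N) * (\<Sum>k<N. e (s k) x * f x)) \<le> b N powr (1 / p)" if "N > 0" for N
  proof -
    have "(\<integral>x. norm (of_real (a N x) * f x) powr p \<partial>M) \<le> (\<integral>x. ?C powr p *
        (real N powr (- p / 4) * indicator E x + real N powr (1 / 2) * (indicator E x * (a N x)\<^sup>2)) \<partial>M)"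
    proof (rule integral_mono')
      show "integrable M (\<lambda>x. ?C powr p *
          (real N powr (- p / 4) * indicator E x + real N powr (1 / 2) * (indicator E x * (a N x)\<^sup>2)))"
        using indE sq[OF that] by simp
      fix x
      show "norm (of_real (a N x) * f x) powr p \<le> ?C powr p *
          (real N powr (- p / 4) * indicator E x + real N powr (1 / 2) * (indicator E x * (a N x)\<^sup>2))"
      proof (cases "x \<in> E")
        case True
        have "norm (f x) \<le> ?C" using C[of x] True by simp
        then have "norm (of_real (a N x) * f x) powr p \<le> (?C * \<bar>a N x\<bar>) powr p"
          using p by (intro powr_mono2) (auto simp: norm_mult mult.commute mult_right_mono)
        also have "\<dots> = ?C powr p * \<bar>a N x\<bar> powr p" by (simp add: powr_mult)
        also have "\<dots> \<le> ?C powr p * (real N powr (- p / 4) + real N powr (1 / 2) * (a N x)\<^sup>2)"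
          using pt[OF that] by (intro mult_left_mono) auto
        finally show ?thesis using True by simp
      next
        case False
        then show ?thesis using C[of x] by simp
      qed
    qed (auto simp: intro!: mult_nonneg_nonneg)
    also have "\<dots> = b N"
      using sq[OF that] indE E sets.sets_into_space[OF E] by (simp add: b_def Int_absorb2)
    finally show ?thesis
      unfolding F Lp_norm_def using p by (intro powr_mono2) auto
  qed
  have "(\<lambda>N. real N powr (- p / 4)) \<longlonglongrightarrow> 0"
    using p by real_asymp
  moreover have "(\<lambda>N. real N powr (1 / 2) * (measure M E / real N)) \<longlonglongrightarrow> 0"
    by real_asymp
  ultimately have "b \<longlonglongrightarrow> ?C powr p * (0 * measure M E + 0)"
    unfolding b_def by (intro tendsto_intros)
  then have b: "b \<longlonglongrightarrow> 0" by simp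
  have "(\<lambda>N. b N powr (1 / p)) \<longlonglongrightarrow> 0"
    using b p by (intro tendsto_zero_powrI[OF b tendsto_const]) (auto simp: b_def)
  then show ?thesis
    by (rule Lim_null_comparison[rotated])
      (use le in \<open>auto intro!: eventually_mono[OF eventually_gt_at_top[of 0]]\<close>)
qed

section \<open>The essential norm of multiplication operators\<close>

lemma Lp_bounded_operator_sum:
  assumes T: "Lp_bounded_operator M p q T" and f: "\<And>k. f k \<in> Lp M p" and p: "0 \<le> p"
  shows "AE x in M. T (\<lambda>y. \<Sum>k<N::nat. f k y) x = (\<Sum>k<N. T (f k) x)"
proof (induction N)
  case 0
  \<comment> \<open>Homogeneity with the scalar 0 makes the image of the zero function vanish almost
    everywhere.\<close>
  show ?case using Lp_bounded_operatorD(4)[OF T zero_mem_Lp, of 0] by simp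
next
  case (Suc N)
  have "AE x in M. T (\<lambda>y. (\<Sum>k<N. f k y) + f N y) x = T (\<lambda>y. \<Sum>k<N. f k y) x + T (f N) x"
    using f p by (intro Lp_bounded_operatorD(3)[OF T] Lp_sum) auto
  with Suc show ?case by eventually_elim simp
qed

text \<open>Dominated convergence with majorant \<open>norm (u x) powr r\<close>. Convergence of the
  sets is stated pointwise so that it serves both the exhaustion of the diffuse part from inside and
  its approximation from outside by removing atoms.\<close>

lemma Lp_norm_indicator_tendsto:
  fixes r :: real
  assumes r: "0 < r" and u: "u \<in> Lp M r" and A: "\<And>n. A n \<in> sets M" "B \<in> sets M"
    and conv: "\<And>x. x \<in> space M \<Longrightarrow> eventually (\<lambda>n. x \<in> A n \<longleftrightarrow> x \<in> B) sequentially"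
  shows "(\<lambda>n. Lp_norm M r (\<lambda>x. indicator (A n) x * u x)) \<longlonglongrightarrow> Lp_norm M r (\<lambda>x. indicator B x * u x)"
proof -
  note [measurable] = Lp_measurable[OF u] A
  have "(\<lambda>n. \<integral>x. norm (indicator (A n) x * u x) powr r \<partial>M) \<longlonglongrightarrow> (\<integral>x. norm (indicator B x * u x) powr r \<partial>M)"
  proof (rule integral_dominated_convergence)
    show "integrable M (\<lambda>x. norm (u x) powr r)" using u by (simp add: Lp_def)
    show "AE x in M. (\<lambda>n. norm (indicator (A n) x * u x) powr r) \<longlonglongrightarrow> norm (indicator B x * u x) powr r"
    proof (rule AE_I2)
      fix x assume "x \<in> space M"
      from conv[OF this]
      have "eventually (\<lambda>n. norm (indicator (A n) x * u x) powr r = norm (indicator B x * u x) powr r) sequentially"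
        by (rule eventually_mono) (auto simp: indicator_def)
      then show "(\<lambda>n. norm (indicator (A n) x * u x) powr r) \<longlonglongrightarrow> norm (indicator B x * u x) powr r"
        by (rule tendsto_eventually)
    qed
  qed (auto simp: indicator_def)
  then show ?thesis
    unfolding Lp_norm_def using r by (intro tendsto_powr2 tendsto_const) auto
qed

section \<open>Lower bound on the diffuse part\<close>

text \<open>The equality case of Hoelder's inequality: \<open>norm (f x) powr p\<close> is
  \<open>norm (v x) powr r\<close> normalised to integral 1, and
  \<open>norm (v x * f x) powr q\<close> is again a multiple of
  \<open>norm (v x) powr r\<close>.\<close>

lemma Lp_norm_extremal_function:
  fixes p q r :: real
  assumes pq: "1 \<le> q" "q < p" "r = p * q / (p - q)" and v: "v \<in> Lp M r" and "Lp_norm M r v \<noteq> 0"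
  defines "f \<equiv> \<lambda>x. of_real ((norm (v x) / Lp_norm M r v) powr (r / p))"
  shows "f \<in> Lp M p" "Lp_norm M p f = 1" "Lp_norm M q (\<lambda>x. v x * f x) = Lp_norm M r v"
proof -
  define N where "N = Lp_norm M r v"
  have pos: "p > 0" "q > 0" "r > 0" using pq by auto
  have N: "N > 0" using assms(5) Lp_norm_nonneg[of M r v] unfolding N_def by linarith
  note [measurable] = Lp_measurable[OF v]
  have int: "integrable M (\<lambda>x. norm (v x) powr r)" using v by (simp add: Lp_def)
  have I: "(\<integral>x. norm (v x) powr r \<partial>M) = N powr r" using pos by (simp add: N_def Lp_norm_powr)
  have nf: "norm (f x) = (norm (v x) / N) powr (r / p)" for x
    by (simp only: f_def norm_of_real N_def abs_of_nonneg powr_ge_zero)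
  then have fp: "norm (f x) powr p = norm (v x) powr r / N powr r" for x
    using pos N by (simp add: powr_powr powr_divide)
  show "f \<in> Lp M p"
    unfolding Lp_def using int by (simp add: fp) (simp add: f_def[abs_def])
  show "Lp_norm M p f = 1"
    unfolding Lp_norm_def fp using N by (simp add: I)
  \<comment> \<open>Both identities restate that \<open>1 / q\<close> is the sum of
    \<open>1 / p\<close> and \<open>1 / r\<close>.\<close>
  have exps: "q + r / p * q = r" "r - r / p * q = q"
  proof -
    have "r * (p - q) = p * q" using pq by simp
    then have "r = (p * q + r * q) / p" using pos by (simp add: field_simps)
    also have "\<dots> = q + r / p * q" using pos by (simp add: add_divide_distrib)
    finally show "q + r / p * q = r" "r - r / p * q = q" by simp_all
  qed
  have vf: "norm (v x * f x) powr q = norm (v x) powr r / N powr (r / p * q)" for x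
  proof -
    have "norm (v x * f x) powr q = norm (v x) powr q * (norm (v x) powr (r / p * q) / N powr (r / p * q))"
      using N by (simp add: nf norm_mult powr_mult powr_powr powr_divide)
    also have "\<dots> = norm (v x) powr (q + r / p * q) / N powr (r / p * q)"
      by (simp only: powr_add times_divide_eq_right)
    finally show ?thesis by (simp only: exps)
  qed
  have "(\<integral>x. norm (v x * f x) powr q \<partial>M) = N powr (r - r / p * q)"
    unfolding vf using I by (simp add: powr_diff)
  also have "\<dots> = N powr q" by (simp only: exps)
  finally show "Lp_norm M q (\<lambda>x. v x * f x) = Lp_norm M r v"
    unfolding Lp_norm_def[of M q] using N pos by (simp add: powr_powr N_def)
qed

text \<open>The unit vectors \<open>h n\<close>, an extremal function times Rademacher signs, all
  have images of norm \<open>N\<close> under multiplication by \<open>u\<close>, while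
  \<open>K\<close> sends a subsequence of them to 0 in norm. Finite measure of \<open>E\<close> and
  the bound on \<open>u\<close> make the extremal function bounded with support in \<open>E\<close>,
  as convergence of the Rademacher averages requires.\<close>

lemma Lp_compact_operator_perturbation_ge:
  fixes p q r :: real
  assumes pq: "1 \<le> q" "q < p" "r = p * q / (p - q)" and u: "u \<in> Lp M r"
    and K: "Lp_compact_operator M p q K"
    and E: "E \<in> sets M" and fin: "emeasure M E \<noteq> \<infinity>"
    and half: "\<And>A. A \<in> sets M \<Longrightarrow> A \<subseteq> E \<Longrightarrow> \<exists>B\<in>sets M. B \<subseteq> A \<and> measure M B = measure M A / 2"
    and B: "\<And>x. x \<in> E \<Longrightarrow> norm (u x) \<le> B"
  shows "Lp_norm M r (\<lambda>x. indicator E x * u x)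
    \<le> Lp_operator_norm M p q (\<lambda>f x. multiplication_operator u f x - K f x)"
proof -
  have pos: "p > 0" "q > 0" "r > 0" "1 \<le> p" using pq by auto
  let ?v = "\<lambda>x. indicator E x * u x" and ?U = "multiplication_operator u"
  let ?D = "\<lambda>f x. ?U f x - K f x"
  define N where "N = Lp_norm M r ?v"
  have Kb: "Lp_bounded_operator M p q K" using K by (rule Lp_compact_operator_imp_bounded)
  have Ub: "Lp_bounded_operator M p q ?U" using pq u by (rule Lp_bounded_multiplication_operator)
  have Db: "Lp_bounded_operator M p q ?D" using Ub Kb pq(1) by (rule Lp_bounded_operator_diff)
  note Kmem = Lp_bounded_operatorD(1)[OF Kb] and Umem = Lp_bounded_operatorD(1)[OF Ub]
  show ?thesis
  proof (cases "N = 0")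
    case True
    then show ?thesis using Lp_operator_norm_nonneg[OF Db] by (simp add: N_def)
  next
    case False
    have v: "?v \<in> Lp M r" using u E pos by (intro indicator_mult_mem_Lp) auto
    have N: "N > 0" using False Lp_norm_nonneg[of M r ?v] unfolding N_def by linarith
    define f :: "'a \<Rightarrow> complex" where "f x = of_real ((norm (?v x) / N) powr (r / p))" for x
    have f: "f \<in> Lp M p" "Lp_norm M p f = 1" "Lp_norm M q (\<lambda>x. ?v x * f x) = N"
      using Lp_norm_extremal_function[OF pq v] False unfolding f_def[abs_def] N_def by auto
    have vf: "?v x * f x = u x * f x" for x by (simp add: f_def indicator_def)
    obtain e where e: "rademacher_on M E e" using exists_rademacher_on[OF E fin half] by auto
    note [measurable] = rademacher_onD(1)[OF e] E Lp_measurable[OF f(1)] Lp_measurable[OF u]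
    define h where "h n x = of_real (e n x) * f x" for n x
    have hf: "norm (h n x) = norm (f x)" for n x
      by (simp add: h_def norm_mult rademacher_onD(2)[OF e])
    have h: "h n \<in> Lp M p" for n
      using f(1) by (simp add: Lp_def hf) (simp add: h_def[abs_def])
    have hnorm: "Lp_norm M p (h n) = 1" for n using f(2) by (simp add: Lp_norm_def hf)
    have Uh: "Lp_norm M q (?U (h n)) = N" for n
      using f(3) unfolding vf by (simp add: Lp_norm_def multiplication_operator_def norm_mult hf)
    obtain s g where s: "strict_mono s" and g: "g \<in> Lp M q"
      and lim: "(\<lambda>n. Lp_norm M q (\<lambda>x. K (h (s n)) x - g x)) \<longlonglongrightarrow> 0"
      by (rule Lp_compact_operatorE[OF K h, where C = 1]) (auto simp: hnorm)
    obtain D where D: "0 \<le> D" "\<And>f. f \<in> Lp M p \<Longrightarrow> Lp_norm M q (K f) \<le> D * Lp_norm M p f"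
      using Lp_bounded_operatorE[OF Kb] by metis
    \<comment> \<open>The averages of \<open>h \<circ> s\<close> tend to \<open>0\<close> in \<open>L\<^sup>p\<close> while their images under \<open>K\<close> tend to \<open>g\<close>.\<close>
    have g0: "Lp_norm M q g = 0"
    proof -
      have "Lp_norm M q g \<le> 0 + \<epsilon>" if "\<epsilon> > 0" for \<epsilon>
      proof -
        obtain k0 where k0: "\<And>n. n \<ge> k0 \<Longrightarrow> Lp_norm M q (\<lambda>x. K (h (s n)) x - g x) < \<epsilon>"
          using order_tendstoD(2)[OF lim \<open>\<epsilon> > 0\<close>] by (auto simp: eventually_sequentially)
        \<comment> \<open>Discarding the first \<open>k0\<close> terms puts every remaining image
          within \<open>\<epsilon>\<close> of \<open>g\<close>, hence also the averages of these
          images.\<close>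
        define t where "t k = s (k + k0)" for k
        have t: "inj t" unfolding t_def inj_def using strict_mono_eq[OF s] by simp
        have near: "Lp_norm M q (\<lambda>x. g x - K (h (t k)) x) \<le> \<epsilon>" for k
          using k0[of "k + k0"] by (subst Lp_norm_diff_commute) (simp add: t_def)
        define A where "A n x = (1 / of_nat n) * (\<Sum>k<n. h (t k) x)" for n :: nat and x
        have A: "A n \<in> Lp M p" for n
          unfolding A_def[abs_def] using h pos by (intro Lp_cmult Lp_sum) auto
        have A0: "(\<lambda>n. Lp_norm M p (A n)) \<longlonglongrightarrow> 0"
        proof -
          \<comment> \<open>The absolute value covers a negative \<open>B\<close>, which is possible
            when \<open>E\<close> is empty.\<close>
          have "norm (f x) \<le> (\<bar>B\<bar> / N) powr (r / p) * indicator E x" for x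
          proof (cases "x \<in> E")
            case True
            have "norm (u x) \<le> \<bar>B\<bar>" using B[OF True] by simp
            then show ?thesis
              using True N pos by (auto simp: f_def intro!: powr_mono2 divide_right_mono)
          qed (simp add: f_def)
          from rademacher_average_tendsto_0[OF e E fin t pos(1) _ this]
          show ?thesis unfolding A_def[abs_def] h_def by simp
        qed
        have le: "Lp_norm M q g \<le> \<epsilon> + D * Lp_norm M p (A n)" if "n > 0" for n
        proof -
          let ?m = "\<lambda>x. (1 / of_nat n) * (\<Sum>k<n. g x - K (h (t k)) x)"
          have "AE x in M. K (\<lambda>y. \<Sum>k<n. h (t k) y) x = (\<Sum>k<n. K (h (t k)) x)"
            using h pos by (intro Lp_bounded_operator_sum[OF Kb]) auto
          moreover have "AE x in M. K (A n) x = (1 / of_nat n) * K (\<lambda>y. \<Sum>k<n. h (t k) y) x"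
            unfolding A_def[abs_def]
            using h pos by (intro Lp_bounded_operatorD(4)[OF Kb] Lp_sum) auto
          \<comment> \<open>Splits \<open>g\<close> into the average distance to the images, of norm
            at most \<open>\<epsilon>\<close>, and the image of the average \<open>A n\<close>,
            whose norm tends to 0.\<close>
          ultimately have ae: "AE x in M. g x = ?m x + K (A n) x"
            by eventually_elim (use that in \<open>simp add: sum_subtractf right_diff_distrib\<close>)
          have diff: "(\<lambda>x. g x - K (h (t k)) x) \<in> Lp M q" for k
            using g Kmem[OF h] pos by (intro Lp_diff) auto
          have m: "?m \<in> Lp M q" using diff pos by (intro Lp_cmult Lp_sum) auto
          have "Lp_norm M q g = Lp_norm M q (\<lambda>x. ?m x + K (A n) x)"
            using ae by (intro Lp_norm_cong_AE Lp_measurable[OF g] borel_measurable_add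
                Lp_measurable[OF m] Lp_measurable[OF Kmem[OF A]])
          also have "\<dots> \<le> Lp_norm M q ?m + Lp_norm M q (K (A n))"
            using m Kmem[OF A] pq(1) by (rule Lp_norm_triangle)
          also have "Lp_norm M q ?m = (1 / n) * Lp_norm M q (\<lambda>x. \<Sum>k<n. g x - K (h (t k)) x)"
            using pos by (simp only: Lp_norm_cmult) (simp add: norm_divide)
          also have "Lp_norm M q (\<lambda>x. \<Sum>k<n. g x - K (h (t k)) x)
              \<le> (\<Sum>k<n. Lp_norm M q (\<lambda>x. g x - K (h (t k)) x))"
            using diff pq(1) by (intro Lp_norm_sum_le) auto
          also have "\<dots> \<le> (\<Sum>k<n. \<epsilon>)" using near by (intro sum_mono)
          also have "(1 / n) * (\<Sum>k<n. \<epsilon>) = \<epsilon>" using that by simp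
          also have "Lp_norm M q (K (A n)) \<le> D * Lp_norm M p (A n)" using D(2)[OF A] .
          finally show ?thesis by (simp add: divide_right_mono)
        qed
        have ev: "eventually (\<lambda>n. Lp_norm M q g \<le> \<epsilon> + D * Lp_norm M p (A n)) sequentially"
          by (rule eventually_mono[OF eventually_gt_at_top[of 0] le])
        have "(\<lambda>n. \<epsilon> + D * Lp_norm M p (A n)) \<longlonglongrightarrow> \<epsilon> + D * 0"
          using A0 by (intro tendsto_intros)
        from tendsto_lowerbound[OF this ev] have "Lp_norm M q g \<le> \<epsilon> + D * 0" by simp
        then show ?thesis by simp
      qed
      then have "Lp_norm M q g \<le> 0" by (rule field_le_epsilon)
      then show ?thesis using Lp_norm_nonneg[of M q g] by linarith
    qed
    have "N \<le> Lp_operator_norm M p q ?D + Lp_norm M q (\<lambda>x. K (h (s n)) x - g x)" for n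
    proof -
      have "N \<le> Lp_norm M q (?D (h (s n))) + Lp_norm M q (K (h (s n)))"
        using Lp_norm_triangle_sub[OF Umem[OF h] Kmem[OF h] pq(1)] by (simp add: Uh)
      moreover have "Lp_norm M q (K (h (s n))) \<le> Lp_norm M q (\<lambda>x. K (h (s n)) x - g x)"
        using Lp_norm_triangle_sub[OF Kmem[OF h] g pq(1), of "s n"] by (simp add: g0)
      moreover have "Lp_norm M q (?D (h (s n))) \<le> Lp_operator_norm M p q ?D"
        using Db h by (rule Lp_norm_le_operator_norm) (simp add: hnorm)
      ultimately show ?thesis by linarith
    qed
    moreover have "(\<lambda>n. Lp_operator_norm M p q ?D + Lp_norm M q (\<lambda>x. K (h (s n)) x - g x))
        \<longlonglongrightarrow> Lp_operator_norm M p q ?D + 0"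
      using lim by (intro tendsto_intros)
    ultimately have "N \<le> Lp_operator_norm M p q ?D + 0"
      by (intro LIMSEQ_le_const) auto
    then show ?thesis by (simp add: N_def)
  qed
qed

text \<open>Diffuseness at the value half the measure of \<open>A\<close>. It only offers values
  strictly between 0 and that measure, so a null set is taken as its own half.\<close>

lemma diffuse_measure_bisect:
  assumes diffuse: "diffuse_measure (restrict_space M S)" and S: "S \<in> sets M"
    and A: "A \<in> sets M" "A \<subseteq> S" and fin: "emeasure M A \<noteq> \<infinity>"
  shows "\<exists>B\<in>sets M. B \<subseteq> A \<and> measure M B = measure M A / 2"
proof (cases "measure M A = 0")
  case True
  then show ?thesis using A by auto
next
  case False
  then have pos: "measure M A > 0" by (simp add: zero_less_measure_iff)
  have em: "emeasure M A = ennreal (measure M A)"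
    using fin by (simp add: emeasure_eq_ennreal_measure)
  have S': "S \<inter> space M \<in> sets M" using S by auto
  have rs: "emeasure (restrict_space M S) C = emeasure M C" if "C \<subseteq> S" for C
    using S' that by (rule emeasure_restrict_space)
  have "A \<in> sets (restrict_space M S)" using A S' by (simp add: sets_restrict_space_iff)
  moreover have "0 < ennreal (measure M A / 2)" "ennreal (measure M A / 2) < emeasure (restrict_space M S) A"
    using pos rs[OF A(2)] by (simp_all add: em ennreal_less_iff)
  ultimately obtain B where B: "B \<in> sets (restrict_space M S)" "B \<subseteq> A"
      "emeasure (restrict_space M S) B = ennreal (measure M A / 2)"
    using diffuse unfolding diffuse_measure_def by blast
  have "emeasure M B = ennreal (measure M A / 2)" using B rs[of B] A by simp
  then have "measure M B = measure M A / 2" by (simp add: measure_def)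
  then show ?thesis using B S' by (auto simp: sets_restrict_space_iff)
qed

text \<open>Truncation: the sets \<open>E k\<close> have finite measure and bounded
  \<open>u\<close>, so the estimate against an arbitrary compact \<open>K\<close> applies to them,
  and they exhaust \<open>S\<close> because the finite-measure sets \<open>C k\<close> increase to
  the whole space.\<close>

lemma Lp_essential_norm_multiplication_ge:
  fixes p q r :: real
  assumes pq: "1 \<le> q" "q < p" "r = p * q / (p - q)" and M: "sigma_finite_measure M"
    and S: "S \<in> sets M" and diffuse: "diffuse_measure (restrict_space M S)" and u: "u \<in> Lp M r"
  shows "Lp_norm M r (\<lambda>x. indicator S x * u x) \<le> Lp_essential_norm M p q (multiplication_operator u)"
proof (rule Lp_essential_norm_ge)
  fix K assume K: "Lp_compact_operator M p q K"
  let ?n = "Lp_operator_norm M p q (\<lambda>f x. multiplication_operator u f x - K f x)"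
  have r: "0 < r" using pq by simp
  note [measurable] = Lp_measurable[OF u] S
  obtain C :: "nat \<Rightarrow> 'a set" where C: "range C \<subseteq> sets M" "(\<Union>i. C i) = space M"
      "\<And>i. emeasure M (C i) \<noteq> \<infinity>" "incseq C"
    using sigma_finite_measure.sigma_finite_incseq[OF M] by metis
  have [measurable]: "C k \<in> sets M" for k using C(1) by auto
  define E where "E k = {x\<in>space M. x \<in> S \<and> x \<in> C k \<and> norm (u x) \<le> real k}" for k
  have E[measurable]: "E k \<in> sets M" for k unfolding E_def by measurable
  have finE: "emeasure M A \<noteq> \<infinity>" if "A \<subseteq> E k" for A k
  proof -
    have "A \<subseteq> C k" using that by (auto simp: E_def)
    then show ?thesis using emeasure_mono[of A "C k" M] C(3)[of k] by (auto simp: top_unique)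
  qed
  have "Lp_norm M r (\<lambda>x. indicator (E k) x * u x) \<le> ?n" for k
  proof (rule Lp_compact_operator_perturbation_ge[OF pq u K E])
    fix A assume "A \<in> sets M" "A \<subseteq> E k"
    then show "\<exists>B\<in>sets M. B \<subseteq> A \<and> measure M B = measure M A / 2"
      using finE by (intro diffuse_measure_bisect[OF diffuse S]) (auto simp: E_def)
  qed (use finE in \<open>auto simp: E_def\<close>)
  moreover have "(\<lambda>k. Lp_norm M r (\<lambda>x. indicator (E k) x * u x)) \<longlonglongrightarrow> Lp_norm M r (\<lambda>x. indicator S x * u x)"
  proof (rule Lp_norm_indicator_tendsto[OF r u E S])
    fix x assume x: "x \<in> space M"
    then obtain i where i: "x \<in> C i" using C(2) by auto
    obtain j where j: "norm (u x) \<le> real j" using real_arch_simple[of "norm (u x)"] by auto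
    have "x \<in> E k \<longleftrightarrow> x \<in> S" if "k \<ge> max i j" for k
      using that x i j incseqD[OF C(4), of i k] by (auto simp: E_def)
    then show "eventually (\<lambda>k. x \<in> E k \<longleftrightarrow> x \<in> S) sequentially"
      using eventually_ge_at_top[of "max i j"] by (rule eventually_mono[rotated])
  qed
  ultimately show "Lp_norm M r (\<lambda>x. indicator S x * u x) \<le> ?n"
    by (intro LIMSEQ_le_const2) auto
qed

section \<open>Upper bound by removing finitely many atoms\<close>

text \<open>Disjointness makes the indicators of the atoms add up, so the operator is a finite sum
  of compact ones.\<close>

lemma Lp_compact_multiplication_atoms:
  fixes p q r :: real
  assumes pq: "1 \<le> q" "q < p" "r = p * q / (p - q)" and u: "u \<in> Lp M r"
    and M: "sigma_finite_measure M"
    and A: "\<And>k :: nat. measure_atom M (A k)" "disjoint_family A"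
  shows "Lp_compact_operator M p q (multiplication_operator (\<lambda>x. indicator (\<Union>k<n::nat. A k) x * u x))"
proof (induction n)
  case 0
  show ?case using zero_Lp_compact_operator by (simp add: multiplication_operator_def[abs_def])
next
  case (Suc n)
  have "A k \<inter> A n = {}" if "k < n" for k
    using A(2) that by (simp add: disjoint_family_on_def)
  then have disj: "(\<Union>k<n. A k) \<inter> A n = {}" by auto
  have "multiplication_operator (\<lambda>x. indicator (\<Union>k<Suc n. A k) x * u x) =
      (\<lambda>f x. multiplication_operator (\<lambda>x. indicator (\<Union>k<n. A k) x * u x) f x +
        multiplication_operator (\<lambda>x. indicator (A n) x * u x) f x)"
    using disj by (intro ext) (auto simp: multiplication_operator_def indicator_def lessThan_Suc)
  then show ?case
    using Lp_compact_operator_add[OF Suc Lp_compact_multiplication_atom[OF pq u A(1)] pq(1)]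
      sigma_finite_measure.emeasure_atom_finite[OF M A(1)] by simp
qed

text \<open>Subtracting the compact multiplication on the first \<open>n\<close> atoms leaves
  multiplication by \<open>u\<close> restricted to their complement \<open>R n\<close>, which
  Hoelder's inequality bounds. As \<open>n\<close> grows, \<open>R n\<close> decreases to
  \<open>S\<close>.\<close>

lemma Lp_essential_norm_multiplication_le:
  fixes p q r :: real
  assumes pq: "1 \<le> q" "q < p" "r = p * q / (p - q)" and u: "u \<in> Lp M r"
    and M: "sigma_finite_measure M"
    and A: "\<And>k :: nat. measure_atom M (A k)" "disjoint_family A"
    and S: "S \<in> sets M" "S \<union> (\<Union>k. A k) = space M" "S \<inter> (\<Union>k. A k) = {}"
  shows "Lp_essential_norm M p q (multiplication_operator u) \<le> Lp_norm M r (\<lambda>x. indicator S x * u x)"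
proof -
  have pos: "0 < p" "0 < r" using pq by auto
  have [measurable]: "A k \<in> sets M" for k using A(1) by (simp add: measure_atom_def)
  note [measurable] = Lp_measurable[OF u]
  define R where "R n = space M - (\<Union>k<n. A k)" for n :: nat
  have R[measurable]: "R n \<in> sets M" for n unfolding R_def by measurable
  have "Lp_essential_norm M p q (multiplication_operator u) \<le> Lp_norm M r (\<lambda>x. indicator (R n) x * u x)" for n
  proof -
    let ?K = "multiplication_operator (\<lambda>x. indicator (\<Union>k<n. A k) x * u x)"
    have Ru: "(\<lambda>x. indicator (R n) x * u x) \<in> Lp M r" using u R pos by (intro indicator_mult_mem_Lp) auto
    have "Lp_essential_norm M p q (multiplication_operator u)
        \<le> Lp_operator_norm M p q (\<lambda>f x. multiplication_operator u f x - ?K f x)"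
      using Lp_essential_norm_le[OF Lp_bounded_multiplication_operator[OF pq u]
          Lp_compact_multiplication_atoms[OF pq u M A] pq(1)] .
    also have "\<dots> \<le> Lp_norm M r (\<lambda>x. indicator (R n) x * u x)"
    proof (rule Lp_operator_norm_le)
      fix f assume f: "f \<in> Lp M p" "Lp_norm M p f \<le> 1"
      note [measurable] = Lp_measurable[OF f(1)]
      have "Lp_norm M q (\<lambda>x. multiplication_operator u f x - ?K f x) =
          Lp_norm M q (\<lambda>x. (indicator (R n) x * u x) * f x)"
        unfolding multiplication_operator_def
        by (intro Lp_norm_cong_AE AE_I2) (auto simp: R_def indicator_def)
      also have "\<dots> \<le> Lp_norm M r (\<lambda>x. indicator (R n) x * u x) * Lp_norm M p f"
        using pq Ru f(1) by (rule Lp_norm_Holder)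
      also have "\<dots> \<le> Lp_norm M r (\<lambda>x. indicator (R n) x * u x)"
        using f(2) by (intro mult_left_le) auto
      finally show "Lp_norm M q (\<lambda>x. multiplication_operator u f x - ?K f x)
          \<le> Lp_norm M r (\<lambda>x. indicator (R n) x * u x)" .
    qed
    finally show ?thesis .
  qed
  moreover have "(\<lambda>n. Lp_norm M r (\<lambda>x. indicator (R n) x * u x)) \<longlonglongrightarrow> Lp_norm M r (\<lambda>x. indicator S x * u x)"
  proof (rule Lp_norm_indicator_tendsto[OF pos(2) u R S(1)])
    fix x assume x: "x \<in> space M"
    show "eventually (\<lambda>n. x \<in> R n \<longleftrightarrow> x \<in> S) sequentially"
    proof (cases "x \<in> S")
      case True
      then have "x \<notin> A k" for k using S(3) by auto
      then show ?thesis using True x by (simp add: R_def)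
    next
      case False
      then obtain k where k: "x \<in> A k" using S x by blast
      have "x \<in> R n \<longleftrightarrow> x \<in> S" if "n > k" for n using that False k by (auto simp: R_def)
      then show ?thesis using eventually_gt_at_top[of k] by (rule eventually_mono[rotated])
    qed
  qed
  ultimately show ?thesis by (intro LIMSEQ_le_const) auto
qed

section \<open>From the decomposition of the space to the two bounds\<close>

text \<open>Atoms of the restricted measure are atoms of \<open>M\<close>, because every measurable
  subset of one stays inside \<open>S\<close>, where both measures agree.\<close>

lemma purely_atomic_measure_restrictE:
  assumes atomic: "purely_atomic_measure (restrict_space M S)" and S: "S \<in> sets M"
  obtains A :: "nat \<Rightarrow> 'a set" where "\<And>k. measure_atom M (A k)" "disjoint_family A" "(\<Union>k. A k) = S"
proof -
  have S': "S \<inter> space M \<in> sets M" using S by auto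
  obtain I :: "nat set" and A where A: "disjoint_family_on A I"
      "\<And>n. n \<in> I \<Longrightarrow> measure_atom (restrict_space M S) (A n)"
      "space (restrict_space M S) = (\<Union>n\<in>I. A n)"
    using atomic unfolding purely_atomic_measure_def by blast
  \<comment> \<open>Padding with the empty set, trivially an atom in the sense of
    \<open>measure_atom\<close>, replaces the index set \<open>I\<close> by all natural
    numbers.\<close>
  define A' where "A' n = (if n \<in> I then A n else {})" for n
  have "measure_atom M (A' n)" for n
  proof (cases "n \<in> I")
    case True
    from A(2)[OF this] have atom: "A n \<in> sets M" "A n \<subseteq> S"
      and *: "\<And>B. B \<in> sets M \<Longrightarrow> B \<subseteq> S \<Longrightarrow> B \<subseteq> A n \<Longrightarrow>
        emeasure (restrict_space M S) B = 0 \<or>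
        emeasure (restrict_space M S) B = emeasure (restrict_space M S) (A n)"
      using S' by (auto simp: measure_atom_def sets_restrict_space_iff)
    have "emeasure M B = 0 \<or> emeasure M B = emeasure M (A n)" if "B \<in> sets M" "B \<subseteq> A n" for B
      using *[of B] that atom emeasure_restrict_space[OF S', of B] emeasure_restrict_space[OF S', of "A n"]
      by auto
    then show ?thesis using True atom by (simp add: A'_def measure_atom_def)
  qed (simp add: A'_def measure_atom_def)
  moreover have "disjoint_family A'"
    using A(1) by (auto simp: disjoint_family_on_def A'_def)
  moreover have "(\<Union>k. A' k) = S"
    using A(3) sets.sets_into_space[OF S] by (auto simp: A'_def space_restrict_space split: if_splits)
  ultimately show thesis by (rule that)
qed

theorem theorem1p3:
  fixes M :: "'a measure" and \<Omega>d \<Omega>a :: "'a set"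
    and p q r :: real and u :: "'a \<Rightarrow> complex"
  assumes "1 \<le> q" and "q < p"
    and "r = p * q / (p - q)"
    and "sigma_finite_measure M"
    and "separable_measure M"
    and "diffuse_atomic_decomposition M \<Omega>d \<Omega>a"
    and "u \<in> Lp M r"
  shows "Lp_essential_norm M p q (multiplication_operator u)
       = (LINT x:\<Omega>d|M. norm (u x) powr r) powr (1 / r)"
proof -
  have dec: "\<Omega>d \<in> sets M" "\<Omega>a \<in> sets M" "\<Omega>d \<inter> \<Omega>a = {}" "\<Omega>d \<union> \<Omega>a = space M"
    "diffuse_measure (restrict_space M \<Omega>d)" "purely_atomic_measure (restrict_space M \<Omega>a)"
    using assms(6) by (auto simp: diffuse_atomic_decomposition_def)
  obtain A :: "nat \<Rightarrow> 'a set" where A: "\<And>k. measure_atom M (A k)" "disjoint_family A" "(\<Union>k. A k) = \<Omega>a"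
    using purely_atomic_measure_restrictE[OF dec(6,2)] by metis
  \<comment> \<open>The indicator can move inside the power because \<open>0 powr r\<close> is
    0.\<close>
  have "(\<lambda>x. indicator \<Omega>d x *\<^sub>R (norm (u x) powr r)) = (\<lambda>x. norm (indicator \<Omega>d x * u x) powr r)"
    by (auto simp: indicator_def)
  then have "(LINT x:\<Omega>d|M. norm (u x) powr r) powr (1 / r) = Lp_norm M r (\<lambda>x. indicator \<Omega>d x * u x)"
    by (simp add: set_lebesgue_integral_def Lp_norm_def)
  moreover have "Lp_essential_norm M p q (multiplication_operator u) \<le> Lp_norm M r (\<lambda>x. indicator \<Omega>d x * u x)"
    using dec A by (intro Lp_essential_norm_multiplication_le[OF assms(1-3,7,4) A(1,2)]) auto
  moreover have "Lp_norm M r (\<lambda>x. indicator \<Omega>d x * u x) \<le> Lp_essential_norm M p q (multiplication_operator u)"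
    using assms(1-4) dec(1,5) assms(7) by (rule Lp_essential_norm_multiplication_ge)
  ultimately show ?thesis by linarith
qed

end
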